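(* Let $g\colon L^2\to\mathbb{S}^n$, $n\geq 3$, be a surface of type $D$ with Gauss curvature $K\neq1$ everywhere, and let $X_g,Y_g\in\mathfrak{X}(L)$ be linearly independent vector fields, with $\|Y_g\|=1$ in the metric induced by $g$, such that everywhere $\langle X_g,Y_g\rangle_g\neq0$, $\nabla^g_{X_g}Y_g=0$ and $\alpha_g(X_g,Y_g)=0$. Then the map $k\colon L^2\to\mathbb{S}^n$ given by $k=g_*Y_g$ also defines a surface of type $D$.
   Context: All objects are smooth; surfaces are immersions. For a surface $g\colon L^2\to\mathbb{S}^n$, $\langle\,,\,\rangle_g$ and $\nabla^g$ denote the induced metric on $L^2$ and its Levi-Civita connection, and $\alpha_g$ the second fundamental form of $g$ in $\mathbb{S}^n$; the Gauss curvature $K$ is that of the induced metric. The unit vector $g_*Y_g$, tangent to $\mathbb{S}^n\subset\mathbb{R}^{n+1}$, is regarded as a point of the unit sphere $\mathbb{S}^n\subset\mathbb{R}^{n+1}$. A surface $g\colon L^2\to\mathbb{S}^n$, $n\geq3$, is of type $D$ if there exist linearly independent vector fields $X,Y\in\mathfrak{X}(L)$ with $\|Y\|=1$ (in the metric induced by $g$) such that everywhere (i) $\langle X,Y\rangle_g\neq0$, (ii) $\nabla^g_XY=0$, (iii) $\alpha_g(X,Y)=0$. That $k$ defines a surface of type $D$ means that $k$ is an immersion and, with its induced metric, is of type $D$. *)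

theory Defs
  imports "HOL-Analysis.Analysis"
begin

section \<open>Smooth maps on open subsets of the plane\<close>

fun times_differentiable_on ::
  "nat \<Rightarrow> 'a::real_normed_vector set \<Rightarrow> ('a \<Rightarrow> 'b::real_normed_vector) \<Rightarrow> bool" where
  "times_differentiable_on 0 S f \<longleftrightarrow> continuous_on S f"
| "times_differentiable_on (Suc k) S f \<longleftrightarrow>
     (\<forall>x\<in>S. f differentiable (at x)) \<and>
     (\<forall>v. times_differentiable_on k S (\<lambda>x. frechet_derivative f (at x) v))"

text \<open>Only meaningful for open \<open>S\<close> (derivatives are taken at \<open>x\<close>, not within \<open>S\<close>), where it is
  the usual notion of a \<open>C\<close>-infinity map.\<close>

definition smooth_on ::
  "'a::real_normed_vector set \<Rightarrow> ('a \<Rightarrow> 'b::real_normed_vector) \<Rightarrow> bool" where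
  "smooth_on S f \<longleftrightarrow> (\<forall>k. times_differentiable_on k S f)"

section \<open>Smooth two-dimensional manifolds\<close>

text \<open>The manifold is the whole type \<open>'l\<close>; Hausdorff and second countable are type class
  constraints. A chart is its domain with its coordinate map; values of the coordinate
  map off the domain are irrelevant.\<close>

type_synonym 'l chart = "'l set \<times> ('l \<Rightarrow> real^2)"

abbreviation dom_of :: "'l chart \<Rightarrow> 'l set" where
  "dom_of \<equiv> fst"

abbreviation coord :: "'l chart \<Rightarrow> 'l \<Rightarrow> real^2" where
  "coord \<equiv> snd"

abbreviation range_of :: "'l chart \<Rightarrow> (real^2) set" where
  "range_of c \<equiv> coord c ` dom_of c"

definition param :: "'l chart \<Rightarrow> real^2 \<Rightarrow> 'l" where
  "param c = inv_into (dom_of c) (coord c)"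

definition is_chart :: "'l::topological_space chart \<Rightarrow> bool" where
  "is_chart c \<longleftrightarrow> open (dom_of c) \<and> open (range_of c) \<and>
     homeomorphism (dom_of c) (range_of c) (coord c) (param c)"

definition smooth_atlas :: "'l::{t2_space,second_countable_topology} chart set \<Rightarrow> bool" where
  "smooth_atlas A \<longleftrightarrow>
     (\<forall>c\<in>A. is_chart c) \<and> (\<Union>c\<in>A. dom_of c) = UNIV \<and>
     (\<forall>c\<in>A. \<forall>d\<in>A. smooth_on (coord c ` (dom_of c \<inter> dom_of d)) (coord d \<circ> param c))"

definition chart_at :: "'l chart set \<Rightarrow> 'l \<Rightarrow> 'l chart" where
  "chart_at A p = (SOME c. c \<in> A \<and> p \<in> dom_of c)"

definition smooth_map :: "'l chart set \<Rightarrow> ('l \<Rightarrow> 'e::real_normed_vector) \<Rightarrow> bool" where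
  "smooth_map A f \<longleftrightarrow> (\<forall>c\<in>A. smooth_on (range_of c) (f \<circ> param c))"

text \<open>A tangent vector at \<open>p\<close> is given by its components in all charts around \<open>p\<close>, subject to
  the usual transformation law. A vector field \<open>X\<close> is represented accordingly: \<open>X c p\<close> are the
  components at \<open>p\<close> in the chart \<open>c\<close>, relevant only for \<open>c \<in> A\<close> and \<open>p \<in> dom_of c\<close>.\<close>

type_synonym 'l vfield = "'l chart \<Rightarrow> 'l \<Rightarrow> real^2"

definition smooth_vector_field :: "'l chart set \<Rightarrow> 'l vfield \<Rightarrow> bool" where
  "smooth_vector_field A X \<longleftrightarrow>
     (\<forall>c\<in>A. smooth_on (range_of c) (X c \<circ> param c)) \<and>
     (\<forall>c\<in>A. \<forall>d\<in>A. \<forall>p \<in> dom_of c \<inter> dom_of d.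
        X d p = frechet_derivative (coord d \<circ> param c) (at (coord c p)) (X c p))"

definition pointwise_independent :: "'l chart set \<Rightarrow> 'l vfield \<Rightarrow> 'l vfield \<Rightarrow> bool" where
  "pointwise_independent A X Y \<longleftrightarrow>
     (\<forall>c\<in>A. \<forall>p\<in>dom_of c. \<forall>a b :: real.
        a *\<^sub>R X c p + b *\<^sub>R Y c p = 0 \<longrightarrow> a = 0 \<and> b = 0)"

text \<open>The function \<open>p \<mapsto> df\<^sub>p(X\<^sub>p)\<close>, for a vector-valued \<open>f\<close>. It does not depend on the chart used
  (lemma \<open>pushforward_in_chart\<close>). It is both the pushforward of \<open>X\<close> by a map
  \<open>f\<close> into a Euclidean space and the derivative of a vector-valued function \<open>f\<close> along \<open>X\<close>.\<close>

definition pushforward ::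
  "'l chart set \<Rightarrow> ('l \<Rightarrow> 'e::real_normed_vector) \<Rightarrow> 'l vfield \<Rightarrow> 'l \<Rightarrow> 'e" where
  "pushforward A f X p =
     (let c = chart_at A p in frechet_derivative (f \<circ> param c) (at (coord c p)) (X c p))"

section \<open>Riemannian metrics on open subsets of the plane\<close>

text \<open>A metric is given by its Gram matrix \<open>h x $ i $ j\<close>.\<close>

definition partial :: "2 \<Rightarrow> (real^2 \<Rightarrow> 'e::real_normed_vector) \<Rightarrow> real^2 \<Rightarrow> 'e" where
  "partial i f x = frechet_derivative f (at x) (axis i 1)"

text \<open>\<open>christoffel h x k i j\<close> has upper index \<open>k\<close>.\<close>

definition christoffel :: "(real^2 \<Rightarrow> real^2^2) \<Rightarrow> real^2 \<Rightarrow> 2 \<Rightarrow> 2 \<Rightarrow> 2 \<Rightarrow> real" where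
  "christoffel h x k i j =
     (1/2) * (\<Sum>l\<in>UNIV. matrix_inv (h x) $ k $ l *
       (partial i (\<lambda>y. h y $ j $ l) x + partial j (\<lambda>y. h y $ i $ l) x
        - partial l (\<lambda>y. h y $ i $ j) x))"

text \<open>The Levi-Civita covariant derivative at \<open>x\<close> of the vector field \<open>V\<close> in direction \<open>u\<close>.\<close>

definition cov_deriv ::
  "(real^2 \<Rightarrow> real^2^2) \<Rightarrow> real^2 \<Rightarrow> (real^2 \<Rightarrow> real^2) \<Rightarrow> real^2 \<Rightarrow> real^2" where
  "cov_deriv h u V x = frechet_derivative V (at x) u +
     (\<chi> k. \<Sum>i\<in>UNIV. \<Sum>j\<in>UNIV. christoffel h x k i j * u $ i * V x $ j)"

text \<open>\<open>R(\<partial>\<^sub>i, \<partial>\<^sub>j) \<partial>\<^sub>k = \<nabla>\<^sub>i \<nabla>\<^sub>j \<partial>\<^sub>k - \<nabla>\<^sub>j \<nabla>\<^sub>i \<partial>\<^sub>k\<close>; coordinate fields commute.\<close>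

definition riemann :: "(real^2 \<Rightarrow> real^2^2) \<Rightarrow> 2 \<Rightarrow> 2 \<Rightarrow> 2 \<Rightarrow> real^2 \<Rightarrow> real^2" where
  "riemann h i j k x =
     cov_deriv h (axis i 1) (cov_deriv h (axis j 1) (\<lambda>_. axis k 1)) x -
     cov_deriv h (axis j 1) (cov_deriv h (axis i 1) (\<lambda>_. axis k 1)) x"

text \<open>\<open>\<langle>R(\<partial>\<^sub>1, \<partial>\<^sub>2) \<partial>\<^sub>2, \<partial>\<^sub>1\<rangle>\<close> divided by the squared area of the coordinate parallelogram; with this
  sign the round unit sphere has curvature \<open>1\<close>.\<close>

definition metric_curvature :: "(real^2 \<Rightarrow> real^2^2) \<Rightarrow> real^2 \<Rightarrow> real" where
  "metric_curvature h x = (riemann h 1 2 2 x \<bullet> (h x *v axis 1 1)) / det (h x)"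

section \<open>Surfaces in the unit sphere\<close>

text \<open>The sphere is \<open>sphere 0 1\<close> in the Euclidean space \<open>'e\<close>; tangent and normal vectors of a surface
  are regarded as vectors in \<open>'e\<close>.\<close>

definition immersed_surface :: "'l chart set \<Rightarrow> ('l \<Rightarrow> 'e::euclidean_space) \<Rightarrow> bool" where
  "immersed_surface A g \<longleftrightarrow>
     smooth_map A g \<and> (\<forall>p. g p \<in> sphere 0 1) \<and>
     (\<forall>c\<in>A. \<forall>p\<in>dom_of c. inj (frechet_derivative (g \<circ> param c) (at (coord c p))))"

definition ind_inner ::
  "'l chart set \<Rightarrow> ('l \<Rightarrow> 'e::euclidean_space) \<Rightarrow> 'l vfield \<Rightarrow> 'l vfield \<Rightarrow> 'l \<Rightarrow> real" where
  "ind_inner A g X Y p = pushforward A g X p \<bullet> pushforward A g Y p"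

definition ind_metric ::
  "('l \<Rightarrow> 'e::euclidean_space) \<Rightarrow> 'l chart \<Rightarrow> real^2 \<Rightarrow> real^2^2" where
  "ind_metric g c x = (\<chi> i j. partial i (g \<circ> param c) x \<bullet> partial j (g \<circ> param c) x)"

definition levi_civita ::
  "('l \<Rightarrow> 'e::euclidean_space) \<Rightarrow> 'l vfield \<Rightarrow> 'l vfield \<Rightarrow> 'l vfield" where
  "levi_civita g X Y c p = cov_deriv (ind_metric g c) (X c p) (Y c \<circ> param c) (coord c p)"

definition gauss_curvature ::
  "'l chart set \<Rightarrow> ('l \<Rightarrow> 'e::euclidean_space) \<Rightarrow> 'l \<Rightarrow> real" where
  "gauss_curvature A g p =
     (let c = chart_at A p in metric_curvature (ind_metric g c) (coord c p))"

text \<open>Covariant derivative in the sphere of a field \<open>V\<close> tangent to the sphere along \<open>g\<close>: the orthogonal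
  projection of the Euclidean derivative onto the tangent space of the sphere at \<open>g p\<close>.\<close>

definition sphere_cov ::
  "'l chart set \<Rightarrow> ('l \<Rightarrow> 'e::euclidean_space) \<Rightarrow> 'l vfield \<Rightarrow> ('l \<Rightarrow> 'e) \<Rightarrow> 'l \<Rightarrow> 'e" where
  "sphere_cov A g X V p = pushforward A V X p - (pushforward A V X p \<bullet> g p) *\<^sub>R g p"

text \<open>The second fundamental form in the sphere, via the Gauss formula.\<close>

definition second_ff ::
  "'l chart set \<Rightarrow> ('l \<Rightarrow> 'e::euclidean_space) \<Rightarrow> 'l vfield \<Rightarrow> 'l vfield \<Rightarrow> 'l \<Rightarrow> 'e" where
  "second_ff A g X Y p =
     sphere_cov A g X (pushforward A g Y) p - pushforward A g (levi_civita g X Y) p"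

definition type_D_fields ::
  "'l chart set \<Rightarrow> ('l \<Rightarrow> 'e::euclidean_space) \<Rightarrow> 'l vfield \<Rightarrow> 'l vfield \<Rightarrow> bool" where
  "type_D_fields A g X Y \<longleftrightarrow>
     smooth_vector_field A X \<and> smooth_vector_field A Y \<and> pointwise_independent A X Y \<and>
     (\<forall>p. sqrt (ind_inner A g Y Y p) = 1) \<and>
     (\<forall>p. ind_inner A g X Y p \<noteq> 0) \<and>
     (\<forall>c\<in>A. \<forall>p\<in>dom_of c. levi_civita g X Y c p = 0) \<and>
     (\<forall>p. second_ff A g X Y p = 0)"

definition type_D :: "'l chart set \<Rightarrow> ('l \<Rightarrow> 'e::euclidean_space) \<Rightarrow> bool" where
  "type_D A g \<longleftrightarrow> immersed_surface A g \<and> (\<exists>X Y. type_D_fields A g X Y)"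

section \<open>Consistency of the coordinate definitions\<close>

lemma smooth_on_differentiable:
  assumes "smooth_on S f" "x \<in> S"
  shows "f differentiable (at x)"
  using assms unfolding smooth_on_def by (metis times_differentiable_on.simps(2))

lemma chart_at:
  assumes "smooth_atlas A"
  shows "chart_at A p \<in> A" "p \<in> dom_of (chart_at A p)"
proof -
  have "\<exists>c. c \<in> A \<and> p \<in> dom_of c"
    using assms unfolding smooth_atlas_def by blast
  then show "chart_at A p \<in> A" "p \<in> dom_of (chart_at A p)"
    unfolding chart_at_def by (metis (mono_tags, lifting) someI_ex)+
qed

lemma pushforward_in_chart:
  assumes A: "smooth_atlas A" and f: "smooth_map A f" and X: "smooth_vector_field A X"
    and c: "c \<in> A" "p \<in> dom_of c"
  shows "pushforward A f X p = frechet_derivative (f \<circ> param c) (at (coord c p)) (X c p)"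
proof -
  define d where "d = chart_at A p"
  have d: "d \<in> A" "p \<in> dom_of d"
    unfolding d_def using chart_at[OF A] by auto
  have chc: "is_chart c" and chd: "is_chart d"
    using A c d unfolding smooth_atlas_def by auto
  define W where "W = coord d ` (dom_of c \<inter> dom_of d)"
  have par: "param e (coord e q) = q" if "is_chart e" "q \<in> dom_of e" for e q
    using that unfolding is_chart_def homeomorphism_def by blast
  have W: "open W"
  proof -
    have "W = range_of d \<inter> param d -` dom_of c"
      unfolding W_def using par[OF chd] by force
    moreover have "continuous_on (range_of d) (param d)" "open (range_of d)" "open (dom_of c)"
      using chd chc unfolding is_chart_def homeomorphism_def by auto
    ultimately show ?thesis
      by (metis Int_commute continuous_on_open_vimage)
  qed
  have pW: "coord d p \<in> W"
    unfolding W_def using c d by blast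
  let ?T = "coord c \<circ> param d"
  have T: "?T differentiable (at (coord d p))"
    using A c d pW unfolding smooth_atlas_def W_def
    by (metis Int_commute smooth_on_differentiable)
  have Tp: "?T (coord d p) = coord c p"
    using par[OF chd d(2)] by simp
  have F: "(f \<circ> param c) differentiable (at (?T (coord d p)))"
    using f c unfolding smooth_map_def Tp
    by (metis image_eqI smooth_on_differentiable)
  have comp: "((f \<circ> param c) \<circ> ?T has_derivative
      frechet_derivative (f \<circ> param c) (at (coord c p)) \<circ>
      frechet_derivative ?T (at (coord d p))) (at (coord d p))"
    using diff_chain_at[OF frechet_derivative_works[THEN iffD1, OF T]
        frechet_derivative_works[THEN iffD1, OF F]] unfolding Tp .
  have eq: "((f \<circ> param c) \<circ> ?T) y = (f \<circ> param d) y" if "y \<in> W" for y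
    using that par[OF chc] par[OF chd] unfolding W_def by auto
  have "(f \<circ> param d has_derivative
      frechet_derivative (f \<circ> param c) (at (coord c p)) \<circ>
      frechet_derivative ?T (at (coord d p))) (at (coord d p))"
    by (rule has_derivative_transform_within_open[OF comp W pW eq])
  then have "frechet_derivative (f \<circ> param d) (at (coord d p)) =
      frechet_derivative (f \<circ> param c) (at (coord c p)) \<circ>
      frechet_derivative ?T (at (coord d p))"
    by (metis frechet_derivative_at)
  moreover have "X c p = frechet_derivative ?T (at (coord d p)) (X d p)"
    using X c d unfolding smooth_vector_field_def by blast
  ultimately show ?thesis
    unfolding pushforward_def d_def[symmetric] Let_def by simp
qed

text \<open>The connection \<open>cov_deriv\<close> is torsion-free and metric, so it is the Levi-Civita connection.\<close>

lemma christoffel_symmetric: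
  assumes "\<And>y i j. h y $ i $ j = h y $ j $ i"
  shows "christoffel h x k i j = christoffel h x k j i"
  unfolding christoffel_def using assms by (simp add: algebra_simps)

lemma christoffel_metric:
  assumes sym: "\<And>y i j. h y $ i $ j = h y $ j $ i" and inv: "invertible (h x)"
  shows "partial i (\<lambda>y. h y $ j $ k) x =
    (\<Sum>m\<in>UNIV. christoffel h x m i j * h x $ m $ k) +
    (\<Sum>m\<in>UNIV. christoffel h x m i k * h x $ j $ m)"
proof -
  have lower: "(\<Sum>m\<in>UNIV. christoffel h x m i j * h x $ m $ k) =
    (1/2) * (partial i (\<lambda>y. h y $ j $ k) x + partial j (\<lambda>y. h y $ i $ k) x
      - partial k (\<lambda>y. h y $ i $ j) x)" for i j k
  proof -
    let ?D = "\<lambda>l. partial i (\<lambda>y. h y $ j $ l) x + partial j (\<lambda>y. h y $ i $ l) x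
      - partial l (\<lambda>y. h y $ i $ j) x"
    have id: "h x ** matrix_inv (h x) = mat 1"
      using inv unfolding invertible_def matrix_inv_def by (rule someI2_ex) blast
    have "(\<Sum>m\<in>UNIV. h x $ k $ m * matrix_inv (h x) $ m $ l) = (if k = l then 1 else 0)" for l
      using arg_cong[OF id, of "\<lambda>M. M $ k $ l"]
      by (simp add: matrix_matrix_mult_def mat_def)
    note e = this
    have "(\<Sum>m\<in>UNIV. christoffel h x m i j * h x $ m $ k) =
      (\<Sum>m\<in>UNIV. \<Sum>l\<in>UNIV. (1/2) * (h x $ k $ m * matrix_inv (h x) $ m $ l) * ?D l)"
      unfolding christoffel_def sym[of x _ k]
      by (simp add: sum_distrib_left sum_distrib_right mult_ac)
    also have "\<dots> = (\<Sum>l\<in>UNIV. (1/2) * (\<Sum>m\<in>UNIV. h x $ k $ m * matrix_inv (h x) $ m $ l) * ?D l)"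
      by (subst sum.swap) (simp add: sum_distrib_left sum_distrib_right)
    also have "\<dots> = (1/2) * ?D k"
      unfolding e by (simp add: if_distrib if_distribR sum.delta cong: if_cong)
    finally show ?thesis .
  qed
  have s: "(\<lambda>y. h y $ a $ b) = (\<lambda>y. h y $ b $ a)" for a b
    using sym by auto
  have "(\<Sum>m\<in>UNIV. christoffel h x m i k * h x $ j $ m) =
    (\<Sum>m\<in>UNIV. christoffel h x m i k * h x $ m $ j)"
    by (simp add: sym[of x j])
  then show ?thesis
    unfolding lower by (simp add: s[of k j] field_simps)
qed

end

theory Submission
  imports Defs
begin

text \<open>Since \<open>\<nabla>\<^sub>X Y = 0\<close> and \<open>\<alpha>(X, Y) = 0\<close>, the Euclidean derivative of \<open>k = g\<^sub>* Y\<close> along \<open>X\<close> has only a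
  component along the position vector: \<open>k\<^sub>* X = - \<langle>X, Y\<rangle> g\<close>. If \<open>k\<close> were not an immersion at a
  point, then \<open>k\<^sub>* Y\<close> would be a multiple of \<open>g\<close> there as well, so \<open>\<alpha>(Y, Y) = 0 = \<alpha>(X, Y)\<close>, and
  the Gauss equation would give \<open>K = 1\<close>. The fields for \<open>k\<close> are \<open>Y\<close>, in the role of \<open>X\<close>, and
  \<open>Z = - X / \<langle>X, Y\<rangle>\<close>, in the role of \<open>Y\<close>. Indeed \<open>k\<^sub>* Z = g\<close>, whose derivative along \<open>Y\<close> is
  \<open>g\<^sub>* Y = k\<close>. This is normal to the sphere at \<open>k\<close>, so both \<open>\<nabla>\<^sub>Y Z\<close> and \<open>\<alpha>(Y, Z)\<close>
  vanish for \<open>k\<close>.\<close>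

section \<open>Calculus of smooth maps\<close>

lemma frechet_derivative_eqI:
  "(f has_derivative F) (at x) \<Longrightarrow> frechet_derivative f (at x) v = F v"
  by (simp add: frechet_derivative_at[symmetric])

section \<open>Closure properties of finite differentiability\<close>

text \<open>On an open set a derivative depends only on the values of the map nearby. This allows
  the derivative of a compound map to be replaced by the formula that a differentiation rule gives
  at the points of \<open>S\<close>, in each closure proof below.\<close>

lemma times_differentiable_on_cong:
  assumes "open S" "\<And>x. x \<in> S \<Longrightarrow> f x = g x" "times_differentiable_on k S f"
  shows "times_differentiable_on k S g"
  using assms(2,3)
proof (induction k arbitrary: f g)
  case 0
  then show ?case using continuous_on_cong[of S S f g] by simp
next
  case (Suc k)
  have der: "(g has_derivative frechet_derivative f (at x)) (at x)" if "x \<in> S" for x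
    using Suc.prems that assms(1)
    by (auto intro: has_derivative_transform_within_open
        simp: frechet_derivative_works)
  have "frechet_derivative f (at x) v = frechet_derivative g (at x) v" if "x \<in> S" for x v
    by (rule frechet_derivative_eqI[OF der[OF that], symmetric])
  then have "times_differentiable_on k S (\<lambda>x. frechet_derivative g (at x) v)" for v
    using Suc.IH[of "\<lambda>x. frechet_derivative f (at x) v"] Suc.prems(2) by simp
  then show ?case using der by (auto simp: differentiable_def)
qed

lemma times_differentiable_on_Suc_imp:
  assumes "times_differentiable_on (Suc k) S f"
  shows "times_differentiable_on k S f"
  using assms
proof (induction k arbitrary: f)
  case 0
  then show ?case
    by (auto intro!: continuous_at_imp_continuous_on differentiable_imp_continuous_within)
next
  case (Suc k)
  have "times_differentiable_on (Suc k) S (\<lambda>x. frechet_derivative f (at x) v)" for v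
    using Suc.prems by (subst (asm) times_differentiable_on.simps(2)) blast
  note Suc.IH[OF this]
  then show ?case using Suc.prems by simp
qed

lemma times_differentiable_on_const: "times_differentiable_on k S (\<lambda>_. c)"
  by (induction k arbitrary: c) simp_all

lemma times_differentiable_on_add:
  assumes "open S" "times_differentiable_on k S f" "times_differentiable_on k S g"
  shows "times_differentiable_on k S (\<lambda>x. f x + g x)"
  using assms(2,3)
proof (induction k arbitrary: f g)
  case 0
  then show ?case by (simp add: continuous_on_add)
next
  case (Suc k)
  have "frechet_derivative f (at x) v + frechet_derivative g (at x) v
      = frechet_derivative (\<lambda>x. f x + g x) (at x) v" if "x \<in> S" for x v
    using that Suc.prems by (auto dest!: bspec[of S _ x]
        intro!: fun_cong[OF frechet_derivative_at, of "\<lambda>v. _ v + _ v"] has_derivative_add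
        simp: frechet_derivative_works)
  then have "times_differentiable_on k S (\<lambda>x. frechet_derivative (\<lambda>x. f x + g x) (at x) v)" for v
    using Suc.prems
    by - (rule times_differentiable_on_cong[OF assms(1) _
        Suc.IH[of "\<lambda>x. frechet_derivative f (at x) v" "\<lambda>x. frechet_derivative g (at x) v"]], auto)
  then show ?case using Suc.prems by auto
qed

lemma (in bounded_linear) times_differentiable_on_compose:
  assumes "open S" "times_differentiable_on k S g"
  shows "times_differentiable_on k S (\<lambda>x. f (g x))"
  using assms(2)
proof (induction k arbitrary: g)
  case 0
  then show ?case by (simp add: continuous_on)
next
  case (Suc k)
  have der: "((\<lambda>x. f (g x)) has_derivative (\<lambda>v. f (frechet_derivative g (at x) v))) (at x)" if "x \<in> S" for x
    using that Suc.prems by (auto intro!: has_derivative simp: frechet_derivative_works[symmetric])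
  have "f (frechet_derivative g (at x) v) = frechet_derivative (\<lambda>x. f (g x)) (at x) v" if "x \<in> S" for x v
    by (rule frechet_derivative_eqI[OF der[OF that], symmetric])
  then have "times_differentiable_on k S (\<lambda>x. frechet_derivative (\<lambda>x. f (g x)) (at x) v)" for v
    using Suc.prems
    by - (rule times_differentiable_on_cong[OF assms(1) _
        Suc.IH[of "\<lambda>x. frechet_derivative g (at x) v"]], auto)
  then show ?case using der by (auto simp: differentiable_def)
qed

lemma (in bounded_bilinear) times_differentiable_on_prod:
  assumes "open S" "times_differentiable_on k S f" "times_differentiable_on k S g"
  shows "times_differentiable_on k S (\<lambda>x. prod (f x) (g x))"
  using assms(2,3)
proof (induction k arbitrary: f g)
  case 0
  then show ?case by (simp add: continuous_on)
next
  case (Suc k)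
  have der: "((\<lambda>x. prod (f x) (g x)) has_derivative
      (\<lambda>v. prod (f x) (frechet_derivative g (at x) v) + prod (frechet_derivative f (at x) v) (g x))) (at x)"
    if "x \<in> S" for x
    using that Suc.prems by (auto intro!: FDERIV simp: frechet_derivative_works[symmetric])
  have "prod (f x) (frechet_derivative g (at x) v) + prod (frechet_derivative f (at x) v) (g x)
      = frechet_derivative (\<lambda>x. prod (f x) (g x)) (at x) v" if "x \<in> S" for x v
    by (rule frechet_derivative_eqI[OF der[OF that], symmetric])
  \<comment> \<open>The product rule pairs each derivative, of order \<open>k\<close>, with an
    undifferentiated factor of order \<open>Suc k\<close>. The latter is lowered to order
    \<open>k\<close>, so that the induction hypothesis, general in both factors, applies to each
    summand.\<close>
  moreover have "times_differentiable_on k S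
      (\<lambda>x. prod (f x) (frechet_derivative g (at x) v) + prod (frechet_derivative f (at x) v) (g x))" for v
    using Suc.prems times_differentiable_on_Suc_imp[OF Suc.prems(1)]
      times_differentiable_on_Suc_imp[OF Suc.prems(2)]
    by (intro times_differentiable_on_add[OF assms(1)] Suc.IH) simp_all
  ultimately have "times_differentiable_on k S (\<lambda>x. frechet_derivative (\<lambda>x. prod (f x) (g x)) (at x) v)" for v
    by (rule times_differentiable_on_cong[OF assms(1)])
  then show ?case using der by (auto simp: differentiable_def)
qed

text \<open>The derivative of the reciprocal is a product containing the reciprocal itself, which
  the induction hypothesis controls one order below. Hence \<open>f\<close> stays fixed in this
  induction.\<close>

lemma times_differentiable_on_inverse:
  fixes f :: "'a::real_normed_vector \<Rightarrow> real"
  assumes "open S" "times_differentiable_on k S f" "\<And>x. x \<in> S \<Longrightarrow> f x \<noteq> 0"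
  shows "times_differentiable_on k S (\<lambda>x. inverse (f x))"
  using assms(2)
proof (induction k)
  case 0
  then show ?case using assms(3) by (simp add: continuous_on_inverse)
next
  case (Suc k)
  have der: "((\<lambda>x. inverse (f x)) has_derivative
      (\<lambda>v. - (inverse (f x) * frechet_derivative f (at x) v * inverse (f x)))) (at x)" if "x \<in> S" for x
    using that Suc.prems assms(3)
    by (intro Deriv.has_derivative_inverse) (auto simp: frechet_derivative_works[symmetric])
  have "- (inverse (f x) * frechet_derivative f (at x) v * inverse (f x))
      = frechet_derivative (\<lambda>x. inverse (f x)) (at x) v" if "x \<in> S" for x v
    by (rule frechet_derivative_eqI[OF der[OF that], symmetric])
  moreover have "times_differentiable_on k S
      (\<lambda>x. - (inverse (f x) * frechet_derivative f (at x) v * inverse (f x)))" for v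
  proof -
    have "times_differentiable_on k S (\<lambda>x. inverse (f x))"
      using Suc.IH times_differentiable_on_Suc_imp[OF Suc.prems] by simp
    moreover have "times_differentiable_on k S (\<lambda>x. frechet_derivative f (at x) v)"
      using Suc.prems by simp
    ultimately show ?thesis
      by (intro bounded_linear.times_differentiable_on_compose[OF bounded_linear_minus[OF bounded_linear_ident]]
          bounded_bilinear.times_differentiable_on_prod[OF bounded_bilinear_mult] assms(1))
  qed
  ultimately have "times_differentiable_on k S (\<lambda>x. frechet_derivative (\<lambda>x. inverse (f x)) (at x) v)" for v
    by (rule times_differentiable_on_cong[OF assms(1)])
  then show ?case using der by (auto simp: differentiable_def)
qed

section \<open>Closure properties of smooth maps\<close>

lemma smooth_on_cong:
  assumes "open S" "\<And>x. x \<in> S \<Longrightarrow> f x = g x" "smooth_on S f"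
  shows "smooth_on S g"
  using assms times_differentiable_on_cong unfolding smooth_on_def by blast

lemma smooth_on_frechet_derivative:
  "smooth_on S f \<Longrightarrow> smooth_on S (\<lambda>x. frechet_derivative f (at x) v)"
  unfolding smooth_on_def using times_differentiable_on.simps(2) by blast

lemma smooth_on_partial: "smooth_on S f \<Longrightarrow> smooth_on S (partial i f)"
  unfolding partial_def by (rule smooth_on_frechet_derivative)

lemma smooth_on_const: "smooth_on S (\<lambda>_. c)"
  by (simp add: smooth_on_def times_differentiable_on_const)

lemma smooth_on_add:
  "open S \<Longrightarrow> smooth_on S f \<Longrightarrow> smooth_on S g \<Longrightarrow> smooth_on S (\<lambda>x. f x + g x)"
  by (simp add: smooth_on_def times_differentiable_on_add)

lemma smooth_on_sum:
  "finite I \<Longrightarrow> open S \<Longrightarrow> (\<And>i. i \<in> I \<Longrightarrow> smooth_on S (f i)) \<Longrightarrow> smooth_on S (\<lambda>x. \<Sum>i\<in>I. f i x)"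
  by (induction rule: finite_induct) (simp_all add: smooth_on_const smooth_on_add)

lemma smooth_on_bounded_linear:
  "bounded_linear h \<Longrightarrow> open S \<Longrightarrow> smooth_on S f \<Longrightarrow> smooth_on S (\<lambda>x. h (f x))"
  by (simp add: smooth_on_def bounded_linear.times_differentiable_on_compose)

lemma smooth_on_bounded_bilinear:
  "bounded_bilinear h \<Longrightarrow> open S \<Longrightarrow> smooth_on S f \<Longrightarrow> smooth_on S g \<Longrightarrow> smooth_on S (\<lambda>x. h (f x) (g x))"
  by (simp add: smooth_on_def bounded_bilinear.times_differentiable_on_prod)

lemmas smooth_on_mult = smooth_on_bounded_bilinear[OF bounded_bilinear_mult]
lemmas smooth_on_scaleR = smooth_on_bounded_bilinear[OF bounded_bilinear_scaleR]
lemmas smooth_on_inner = smooth_on_bounded_bilinear[OF bounded_bilinear_inner]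
lemmas smooth_on_vec_nth = smooth_on_bounded_linear[OF bounded_linear_vec_nth]
lemmas smooth_on_minus = smooth_on_bounded_linear[OF bounded_linear_minus[OF bounded_linear_ident]]

lemma smooth_on_diff:
  "open S \<Longrightarrow> smooth_on S f \<Longrightarrow> smooth_on S g \<Longrightarrow> smooth_on S (\<lambda>x. f x - g x)"
  using smooth_on_add[of S f "\<lambda>x. - g x"] smooth_on_minus[of S g] by simp

lemma smooth_on_inverse:
  fixes f :: "'a::real_normed_vector \<Rightarrow> real"
  shows "open S \<Longrightarrow> smooth_on S f \<Longrightarrow> (\<And>x. x \<in> S \<Longrightarrow> f x \<noteq> 0) \<Longrightarrow> smooth_on S (\<lambda>x. inverse (f x))"
  by (simp add: smooth_on_def times_differentiable_on_inverse)

lemma frechet_derivative_real2: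
  fixes f :: "real^2 \<Rightarrow> 'b::real_normed_vector"
  assumes "f differentiable (at x)"
  shows "frechet_derivative f (at x) v = v $ 1 *\<^sub>R partial 1 f x + v $ 2 *\<^sub>R partial 2 f x"
proof -
  have "linear (frechet_derivative f (at x))"
    using assms by (rule linear_frechet_derivative)
  then have "v $ 1 *\<^sub>R partial 1 f x + v $ 2 *\<^sub>R partial 2 f x =
      frechet_derivative f (at x) (v $ 1 *\<^sub>R axis 1 1 + v $ 2 *\<^sub>R axis 2 1)"
    unfolding partial_def by (simp add: linear_add linear_scale)
  also have "v $ 1 *\<^sub>R axis 1 1 + v $ 2 *\<^sub>R axis 2 1 = v"
    by (simp add: vec_eq_iff forall_2 axis_def)
  finally show ?thesis by simp
qed

text \<open>Smoothness is defined by derivatives in constant directions. Expanding the moving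
  direction \<open>V x\<close> in the coordinate basis reduces to these, with smooth
  coefficients.\<close>

lemma smooth_on_frechet_derivative_field:
  fixes f :: "real^2 \<Rightarrow> 'b::real_normed_vector"
  assumes "open S" "smooth_on S f" "smooth_on S V"
  shows "smooth_on S (\<lambda>x. frechet_derivative f (at x) (V x))"
proof (rule smooth_on_cong[OF assms(1)])
  show "V x $ 1 *\<^sub>R partial 1 f x + V x $ 2 *\<^sub>R partial 2 f x = frechet_derivative f (at x) (V x)"
    if "x \<in> S" for x
    using that assms(2) by (simp add: frechet_derivative_real2 smooth_on_differentiable)
  show "smooth_on S (\<lambda>x. V x $ 1 *\<^sub>R partial 1 f x + V x $ 2 *\<^sub>R partial 2 f x)"
    by (intro smooth_on_add smooth_on_scaleR smooth_on_vec_nth smooth_on_partial assms)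
qed

lemma smooth_on_vec_lambda:
  fixes f :: "'a::real_normed_vector \<Rightarrow> 'n::finite \<Rightarrow> real"
  assumes "open S" "\<And>i. smooth_on S (\<lambda>x. f x i)"
  shows "smooth_on S (\<lambda>x. \<chi> i. f x i)"
proof (rule smooth_on_cong[OF assms(1)])
  show "(\<Sum>i\<in>UNIV. f x i *\<^sub>R axis i 1) = (\<chi> i. f x i)" for x
    by (simp add: vec_eq_iff axis_def if_distrib cong: if_cong)
  show "smooth_on S (\<lambda>x. \<Sum>i\<in>UNIV. f x i *\<^sub>R (axis i 1 :: real^'n))"
    using assms by (intro smooth_on_sum smooth_on_scaleR smooth_on_const) auto
qed

section \<open>Symmetry of second derivatives\<close>

lemma has_real_derivative_along_line:
  fixes f :: "'a::real_normed_vector \<Rightarrow> real"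
  assumes "f differentiable (at (a + s *\<^sub>R v))"
  shows "((\<lambda>s. f (a + s *\<^sub>R v)) has_real_derivative
    frechet_derivative f (at (a + s *\<^sub>R v)) v) (at s)"
proof -
  let ?D = "frechet_derivative f (at (a + s *\<^sub>R v))"
  have "((\<lambda>s. a + s *\<^sub>R v) has_derivative (\<lambda>h. h *\<^sub>R v)) (at s)"
    by (auto intro!: derivative_eq_intros)
  moreover have "(f has_derivative ?D) (at (a + s *\<^sub>R v))"
    using assms frechet_derivative_works by blast
  ultimately have "((\<lambda>s. f (a + s *\<^sub>R v)) has_derivative (\<lambda>h. ?D (h *\<^sub>R v))) (at s)"
    by (rule has_derivative_compose)
  moreover have "(\<lambda>h. ?D (h *\<^sub>R v)) = (\<lambda>h. ?D v * h)"
    using linear_frechet_derivative[OF assms] by (auto simp: linear_scale fun_eq_iff)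
  ultimately show ?thesis by (simp add: has_field_derivative_def)
qed

text \<open>The second difference of \<open>f\<close> on a small parallelogram, by applying the mean value theorem
  twice. It is symmetric in the two directions, which is where the symmetry of the second
  derivative comes from.\<close>

lemma second_difference_mean_value:
  fixes f :: "'a::real_normed_vector \<Rightarrow> real"
  assumes "smooth_on S f" "s > 0"
    and S: "\<And>a b. 0 \<le> a \<Longrightarrow> a \<le> s \<Longrightarrow> 0 \<le> b \<Longrightarrow> b \<le> s \<Longrightarrow> x + a *\<^sub>R v + b *\<^sub>R w \<in> S"
  obtains a b where "0 \<le> a" "a \<le> s" "0 \<le> b" "b \<le> s"
    "f (x + s *\<^sub>R v + s *\<^sub>R w) - f (x + s *\<^sub>R v) - f (x + s *\<^sub>R w) + f x =
     s * s * frechet_derivative (\<lambda>y. frechet_derivative f (at y) v) (at (x + a *\<^sub>R v + b *\<^sub>R w)) w"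
proof -
  let ?D = "\<lambda>y. frechet_derivative f (at y) v"
  have S': "x + a *\<^sub>R v + b *\<^sub>R w \<in> S" "x + b *\<^sub>R w + a *\<^sub>R v \<in> S"
    if "0 \<le> a" "a \<le> s" "0 \<le> b" "b \<le> s" for a b
    using S[OF that] by (simp_all add: algebra_simps)
  have "\<exists>a>0. a < s \<and>
    (f (x + s *\<^sub>R w + s *\<^sub>R v) - f (x + s *\<^sub>R v)) - (f (x + s *\<^sub>R w + 0 *\<^sub>R v) - f (x + 0 *\<^sub>R v))
      = (s - 0) * (?D (x + s *\<^sub>R w + a *\<^sub>R v) - ?D (x + a *\<^sub>R v))"
    using assms(2) S'[of _ 0] S'[of _ s]
    by (intro MVT2 DERIV_diff has_real_derivative_along_line smooth_on_differentiable[OF assms(1)])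
      auto
  then obtain a where a: "0 < a" "a < s" and
    1: "(f (x + s *\<^sub>R w + s *\<^sub>R v) - f (x + s *\<^sub>R v)) - (f (x + s *\<^sub>R w) - f x)
      = s * (?D (x + s *\<^sub>R w + a *\<^sub>R v) - ?D (x + a *\<^sub>R v))" by auto
  have "\<exists>b>0. b < s \<and> ?D (x + a *\<^sub>R v + s *\<^sub>R w) - ?D (x + a *\<^sub>R v + 0 *\<^sub>R w)
      = (s - 0) * frechet_derivative ?D (at (x + a *\<^sub>R v + b *\<^sub>R w)) w"
    using assms(2) a S'[of a]
    by (intro MVT2 has_real_derivative_along_line
        smooth_on_differentiable[OF smooth_on_frechet_derivative[OF assms(1)]]) auto
  then obtain b where b: "0 < b" "b < s" and
    2: "?D (x + a *\<^sub>R v + s *\<^sub>R w) - ?D (x + a *\<^sub>R v)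
      = s * frechet_derivative ?D (at (x + a *\<^sub>R v + b *\<^sub>R w)) w" by auto
  show thesis
    using a b 1 2 by (intro that[of a b]) (simp_all add: algebra_simps)
qed

text \<open>One and the same second difference is \<open>s * s\<close> times a value of either mixed
  derivative, at two points of a small parallelogram. By continuity both values are close to those
  at \<open>x\<close>, so the mixed derivatives at \<open>x\<close> differ by arbitrarily
  little.\<close>

lemma second_derivative_symmetric_real:
  fixes f :: "'a::real_normed_vector \<Rightarrow> real"
  assumes "open S" "smooth_on S f" "x \<in> S"
  shows "frechet_derivative (\<lambda>y. frechet_derivative f (at y) v) (at x) w =
         frechet_derivative (\<lambda>y. frechet_derivative f (at y) w) (at x) v"
proof -
  define H where "H v w y = frechet_derivative (\<lambda>y. frechet_derivative f (at y) v) (at y) w" for v w y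
  have cont: "isCont (H v w) x" for v w
  proof -
    have "smooth_on S (H v w)"
      unfolding H_def by (intro smooth_on_frechet_derivative assms)
    then show ?thesis
      using assms(3) differentiable_imp_continuous_within smooth_on_differentiable by blast
  qed
  have "\<bar>H v w x - H w v x\<bar> \<le> e" if "e > 0" for e
  proof -
    have "\<forall>\<^sub>F y in nhds x. y \<in> S \<and> dist (H v w y) (H v w x) < e/2 \<and> dist (H w v y) (H w v x) < e/2"
      using assms(1,3) that cont[of v w] cont[of w v]
      by (intro eventually_conj eventually_nhds_in_open tendstoD)
        (auto simp: isCont_def tendsto_at_iff_tendsto_nhds)
    then obtain d where d: "d > 0" "\<And>y. dist y x < d \<Longrightarrow>
        y \<in> S \<and> dist (H v w y) (H v w x) < e/2 \<and> dist (H w v y) (H w v x) < e/2"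
      unfolding eventually_nhds_metric by blast
    \<comment> \<open>The summand 1 keeps \<open>m\<close> positive when both directions vanish. The
      side length \<open>s\<close> then confines the parallelogram to the ball of radius
      \<open>d\<close>.\<close>
    define m where "m = norm v + norm w + 1"
    define s where "s = d / (2 * m)"
    have pos: "m > 0"
      by (simp add: m_def add_nonneg_pos)
    then have s: "s > 0"
      using d(1) by (simp add: s_def)
    have near: "dist (x + a *\<^sub>R v + b *\<^sub>R w) x < d" "dist (x + b *\<^sub>R w + a *\<^sub>R v) x < d"
      if "0 \<le> a" "a \<le> s" "0 \<le> b" "b \<le> s" for a b
    proof -
      have "norm (a *\<^sub>R v + b *\<^sub>R w) \<le> a * norm v + b * norm w"
        using norm_triangle_ineq[of "a *\<^sub>R v" "b *\<^sub>R w"] that by simp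
      also have "\<dots> \<le> s * norm v + s * norm w"
        using that by (intro add_mono mult_right_mono) auto
      also have "\<dots> < 2 * (s * m)"
        using s by (simp add: m_def algebra_simps add_nonneg_pos)
      also have "\<dots> = d"
        using pos by (simp add: s_def)
      finally show "dist (x + a *\<^sub>R v + b *\<^sub>R w) x < d" "dist (x + b *\<^sub>R w + a *\<^sub>R v) x < d"
        by (simp_all add: dist_norm algebra_simps)
    qed
    obtain a b where 1: "0 \<le> a" "a \<le> s" "0 \<le> b" "b \<le> s"
      "f (x + s *\<^sub>R v + s *\<^sub>R w) - f (x + s *\<^sub>R v) - f (x + s *\<^sub>R w) + f x =
        s * s * H v w (x + a *\<^sub>R v + b *\<^sub>R w)"
      unfolding H_def using near d(2) s by (elim second_difference_mean_value[OF assms(2), rotated 2]) auto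
    obtain a' b' where 2: "0 \<le> a'" "a' \<le> s" "0 \<le> b'" "b' \<le> s"
      "f (x + s *\<^sub>R w + s *\<^sub>R v) - f (x + s *\<^sub>R w) - f (x + s *\<^sub>R v) + f x =
        s * s * H w v (x + a' *\<^sub>R w + b' *\<^sub>R v)"
      unfolding H_def using near d(2) s by (elim second_difference_mean_value[OF assms(2), rotated 2]) auto
    have "s * s * H v w (x + a *\<^sub>R v + b *\<^sub>R w) = s * s * H w v (x + a' *\<^sub>R w + b' *\<^sub>R v)"
      using 1(5) 2(5) by (simp add: algebra_simps)
    then have eq: "H v w (x + a *\<^sub>R v + b *\<^sub>R w) = H w v (x + a' *\<^sub>R w + b' *\<^sub>R v)"
      using s by simp
    have "dist (H v w (x + a *\<^sub>R v + b *\<^sub>R w)) (H v w x) < e/2"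
      using d(2) near 1 by blast
    moreover have "dist (H v w (x + a *\<^sub>R v + b *\<^sub>R w)) (H w v x) < e/2"
      unfolding eq using d(2) near 2 by blast
    ultimately have "dist (H v w x) (H w v x) < e"
      by (rule dist_triangle_half_r)
    then show ?thesis by (simp add: dist_real_def)
  qed
  then have "\<bar>H v w x - H w v x\<bar> \<le> 0"
    by - (rule field_le_epsilon, simp only: add_0)
  then have "H v w x = H w v x"
    by simp
  then show ?thesis by (simp only: H_def)
qed

lemma inner_frechet_derivative:
  assumes "f differentiable (at x)"
  shows "frechet_derivative (\<lambda>y. f y \<bullet> b) (at x) v = frechet_derivative f (at x) v \<bullet> b"
proof -
  have "((\<lambda>y. f y \<bullet> b) has_derivative (\<lambda>v. frechet_derivative f (at x) v \<bullet> b)) (at x)"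
    using assms by (intro has_derivative_inner_left) (simp add: frechet_derivative_works[symmetric])
  then show ?thesis by (rule frechet_derivative_eqI)
qed

text \<open>Testing against a basis vector commutes with differentiation, which reduces the claim to
  real-valued maps.\<close>

lemma second_derivative_symmetric:
  fixes f :: "'a::real_normed_vector \<Rightarrow> 'b::euclidean_space"
  assumes "open S" "smooth_on S f" "x \<in> S"
  shows "frechet_derivative (\<lambda>y. frechet_derivative f (at y) v) (at x) w =
         frechet_derivative (\<lambda>y. frechet_derivative f (at y) w) (at x) v"
proof (rule euclidean_eqI)
  fix b :: 'b
  have *: "frechet_derivative (\<lambda>y. frechet_derivative f (at y) v) (at x) w \<bullet> b =
    frechet_derivative (\<lambda>y. frechet_derivative (\<lambda>y. f y \<bullet> b) (at y) v) (at x) w" for v w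
  proof -
    let ?F = "\<lambda>y. frechet_derivative f (at y) v"
    have "((\<lambda>y. ?F y \<bullet> b) has_derivative (\<lambda>w. frechet_derivative ?F (at x) w \<bullet> b)) (at x)"
      using smooth_on_differentiable[OF smooth_on_frechet_derivative[OF assms(2)] assms(3)]
      by (intro has_derivative_inner_left) (simp add: frechet_derivative_works[symmetric])
    then have "((\<lambda>y. frechet_derivative (\<lambda>y. f y \<bullet> b) (at y) v) has_derivative
      (\<lambda>w. frechet_derivative ?F (at x) w \<bullet> b)) (at x)"
      by (rule has_derivative_transform_within_open[OF _ assms(1,3)])
        (simp add: inner_frechet_derivative smooth_on_differentiable[OF assms(2)])
    then show ?thesis by (simp add: frechet_derivative_eqI)
  qed
  have "smooth_on S (\<lambda>y. f y \<bullet> b)"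
    using assms by (intro smooth_on_inner smooth_on_const)
  then show "frechet_derivative (\<lambda>y. frechet_derivative f (at y) v) (at x) w \<bullet> b =
         frechet_derivative (\<lambda>y. frechet_derivative f (at y) w) (at x) v \<bullet> b"
    unfolding * by (intro second_derivative_symmetric_real[OF assms(1) _ assms(3)])
qed

section \<open>The Gauss equation in a chart\<close>

text \<open>The product rule for a constant inner product. It serves to move a derivative between
  orthogonal fields, and to show that a map of constant length is orthogonal to its
  derivative.\<close>

lemma inner_derivative_eq_minus:
  assumes "open U" "\<And>y. y \<in> U \<Longrightarrow> F y \<bullet> G y = c" "x \<in> U"
    and "F differentiable (at x)" "G differentiable (at x)"
  shows "frechet_derivative F (at x) v \<bullet> G x = - (F x \<bullet> frechet_derivative G (at x) v)"
proof -
  have "((\<lambda>y. F y \<bullet> G y) has_derivative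
      (\<lambda>v. F x \<bullet> frechet_derivative G (at x) v + frechet_derivative F (at x) v \<bullet> G x)) (at x)"
    using assms(4,5) by (intro has_derivative_inner) (simp_all add: frechet_derivative_works[symmetric])
  moreover have "((\<lambda>y. F y \<bullet> G y) has_derivative (\<lambda>_. 0)) (at x)"
    by (rule has_derivative_transform_within_open[OF has_derivative_const assms(1,3)]) (simp add: assms(2))
  ultimately have "F x \<bullet> frechet_derivative G (at x) v + frechet_derivative F (at x) v \<bullet> G x = 0"
    using has_derivative_unique by metis
  then show ?thesis by linarith
qed

section \<open>Smoothness of the inverse metric\<close>

lemma matrix_inv_2:
  fixes M :: "real^2^2"
  assumes "det M \<noteq> 0"
  shows "matrix_inv M =
    vector [vector [M $ 2 $ 2 / det M, - M $ 1 $ 2 / det M], vector [- M $ 2 $ 1 / det M, M $ 1 $ 1 / det M]]"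
    (is "_ = ?N")
proof -
  define d where "d = det M"
  have d: "d \<noteq> 0" "d = M $ 1 $ 1 * M $ 2 $ 2 - M $ 1 $ 2 * M $ 2 $ 1"
    using assms by (simp_all add: d_def det_2)
  have inv: "M ** ?N = mat 1" "?N ** M = mat 1"
    unfolding d_def[symmetric] vec_eq_iff forall_2 matrix_matrix_mult_def sum_2 mat_def
    using d by (simp_all add: vector_2 field_simps)
  then have "M ** matrix_inv M = mat 1 \<and> matrix_inv M ** M = mat 1"
    unfolding matrix_inv_def
    by - (rule someI[of "\<lambda>B. M ** B = mat 1 \<and> B ** M = mat 1" ?N], blast)
  \<comment> \<open>\<open>matrix_inv\<close> is chosen as some two-sided inverse; associativity
    shows that it is the explicit one.\<close>
  then have "matrix_inv M ** (M ** ?N) = ?N"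
    by (simp add: matrix_mul_assoc)
  then show ?thesis
    unfolding inv matrix_mul_rid .
qed

text \<open>By the explicit formula each entry is, up to sign, an entry of \<open>h x\<close> times
  the reciprocal of the determinant.\<close>

lemma smooth_on_matrix_inv:
  fixes h :: "'a::real_normed_vector \<Rightarrow> real^2^2"
  assumes "open U" "\<And>i j. smooth_on U (\<lambda>x. h x $ i $ j)" "\<And>x. x \<in> U \<Longrightarrow> det (h x) \<noteq> 0"
  shows "smooth_on U (\<lambda>x. matrix_inv (h x) $ k $ l)"
proof -
  have "smooth_on U (\<lambda>x. inverse (det (h x)))"
    using assms unfolding det_2
    by (intro smooth_on_inverse smooth_on_diff smooth_on_mult) (auto simp: det_2)
  then have s: "smooth_on U (\<lambda>x. h x $ i $ j * inverse (det (h x)))" for i j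
    by (intro smooth_on_mult assms)
  note s = s smooth_on_minus[OF assms(1) s]
  have "smooth_on U (\<lambda>x. (vector [vector [h x $ 2 $ 2 / det (h x), - h x $ 1 $ 2 / det (h x)],
      vector [- h x $ 2 $ 1 / det (h x), h x $ 1 $ 1 / det (h x)]] :: real^2^2) $ k $ l)"
    using s exhaust_2[of k] exhaust_2[of l] by (auto simp: vector_2 divide_inverse)
  then show ?thesis
    by (rule smooth_on_cong[OF assms(1), rotated]) (simp add: matrix_inv_2 assms(3))
qed

definition gram :: "(real^2 \<Rightarrow> 'e::euclidean_space) \<Rightarrow> real^2 \<Rightarrow> real^2^2" where
  "gram f x = (\<chi> i j. partial i f x \<bullet> partial j f x)"

lemma gram_sym: "gram f x $ i $ j = gram f x $ j $ i"
  by (simp add: gram_def inner_commute)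

text \<open>\<open>connection h j k\<close> is the coordinate expression of \<open>\<nabla>\<^sub>j \<partial>\<^sub>k\<close>.\<close>

definition connection :: "(real^2 \<Rightarrow> real^2^2) \<Rightarrow> 2 \<Rightarrow> 2 \<Rightarrow> real^2 \<Rightarrow> real^2" where
  "connection h j k x = (\<chi> m. christoffel h x m j k)"

lemma cov_deriv_connection:
  "cov_deriv h u V x = frechet_derivative V (at x) u +
    (\<Sum>i\<in>UNIV. \<Sum>j\<in>UNIV. (u $ i * V x $ j) *\<^sub>R connection h i j x)"
  by (simp add: cov_deriv_def connection_def vec_eq_iff sum_2 mult_ac)

lemma cov_deriv_axis: "cov_deriv h (axis i 1) (\<lambda>_. axis j 1) = connection h i j"
proof
  show "cov_deriv h (axis i 1) (\<lambda>_. axis j 1) x = connection h i j x" for x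
    using exhaust_2[of i] exhaust_2[of j]
    by (auto simp: cov_deriv_connection sum_2 axis_def)
qed

section \<open>Gauss formula and Gauss equation in Euclidean space\<close>

locale immersed_patch =
  fixes U :: "(real^2) set" and f :: "real^2 \<Rightarrow> 'e::euclidean_space"
  assumes open_U: "open U" and smooth_f: "smooth_on U f"
    and inj_f: "x \<in> U \<Longrightarrow> inj (frechet_derivative f (at x))"
begin

abbreviation df :: "real^2 \<Rightarrow> real^2 \<Rightarrow> 'e" where
  "df x \<equiv> frechet_derivative f (at x)"

lemma differentiable_f: "x \<in> U \<Longrightarrow> f differentiable (at x)"
  using smooth_f smooth_on_differentiable by blast

lemma differentiable_partial: "x \<in> U \<Longrightarrow> partial i f differentiable (at x)"
  using smooth_f smooth_on_partial smooth_on_differentiable by blast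

lemma linear_df: "x \<in> U \<Longrightarrow> linear (df x)"
  by (intro linear_frechet_derivative differentiable_f)

lemma df_eq: "x \<in> U \<Longrightarrow> df x v = v $ 1 *\<^sub>R partial 1 f x + v $ 2 *\<^sub>R partial 2 f x"
  by (intro frechet_derivative_real2 differentiable_f)

lemma df_eq_0: "x \<in> U \<Longrightarrow> df x v = 0 \<longleftrightarrow> v = 0"
  using inj_f linear_df linear_injective_0 linear_0 by metis

lemma inner_gram: "x \<in> U \<Longrightarrow> v \<bullet> (gram f x *v w) = df x v \<bullet> df x w"
  by (simp add: df_eq gram_def matrix_vector_mult_def inner_vec_def sum_2 inner_add inner_commute
      algebra_simps)

lemma invertible_gram: assumes "x \<in> U" shows "invertible (gram f x)"
proof -
  have "w = 0" if "gram f x *v w = 0" for w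
  proof -
    have "df x w \<bullet> df x w = 0"
      using inner_gram[OF assms, of w w] that by simp
    then show ?thesis using df_eq_0[OF assms] by simp
  qed
  then show ?thesis
    unfolding invertible_left_inverse matrix_left_invertible_ker by blast
qed

lemma smooth_gram: "smooth_on U (\<lambda>x. gram f x $ i $ j)"
  by (simp add: gram_def smooth_on_inner open_U smooth_on_partial smooth_f)

lemma smooth_connection: "smooth_on U (connection (gram f) i j)"
proof -
  have "smooth_on U (\<lambda>x. matrix_inv (gram f x) $ k $ l)" for k l
    using invertible_gram by (intro smooth_on_matrix_inv open_U smooth_gram) (simp add: invertible_det_nz)
  then show ?thesis
    unfolding connection_def christoffel_def
    by (intro smooth_on_vec_lambda smooth_on_mult smooth_on_const smooth_on_sum smooth_on_diff
        smooth_on_add smooth_on_partial smooth_gram open_U finite)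
qed

lemma partial_commute:
  fixes F :: "real^2 \<Rightarrow> 'f::euclidean_space"
  assumes "smooth_on U F" "x \<in> U"
  shows "partial i (partial j F) x = partial j (partial i F) x"
  unfolding partial_def using second_derivative_symmetric[OF open_U assms] .

text \<open>This is the uniqueness of the Levi-Civita connection: the tangential part of the second
  derivatives is also symmetric and compatible with the metric, so it has the same Christoffel
  symbols.\<close>

lemma df_connection_inner:
  assumes x: "x \<in> U"
  shows "df x (connection (gram f) i j x) \<bullet> partial k f x = partial i (partial j f) x \<bullet> partial k f x"
proof -
  define L where "L i j k = (\<Sum>m\<in>UNIV. christoffel (gram f) x m i j * gram f x $ m $ k)" for i j k
  define G where "G i j k = partial i (partial j f) x \<bullet> partial k f x" for i j k
  have "partial i (\<lambda>y. gram f y $ j $ k) x = G i j k + G i k j" for i j k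
  proof -
    have "((\<lambda>y. partial j f y \<bullet> partial k f y) has_derivative
      (\<lambda>v. partial j f x \<bullet> frechet_derivative (partial k f) (at x) v +
        frechet_derivative (partial j f) (at x) v \<bullet> partial k f x)) (at x)"
      using differentiable_partial[OF x]
      by (intro has_derivative_inner) (simp_all add: frechet_derivative_works[symmetric])
    then show ?thesis
      by (simp add: partial_def[of i] gram_def G_def frechet_derivative_eqI inner_commute)
  qed
  moreover have "partial i (\<lambda>y. gram f y $ j $ k) x = L i j k + L i k j" for i j k
    using christoffel_metric[of "gram f", OF gram_sym invertible_gram[OF x]]
    by (simp add: L_def gram_sym[of f x j])
  ultimately have LG: "L i j k + L i k j = G i j k + G i k j" for i j k
    by metis
  have "L i j k = L j i k" for i j k
    unfolding L_def using christoffel_symmetric[of "gram f", OF gram_sym] by metis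
  moreover have "G i j k = G j i k" for i j k
    unfolding G_def using partial_commute[OF smooth_f x] by metis
  \<comment> \<open>The difference of \<open>L\<close> and \<open>G\<close> is symmetric in the
    first two indices and antisymmetric in the last two. Permuting the indices cyclically shows that
    it equals its own negative.\<close>
  ultimately have "L i j k = G i j k" for i j k
    using LG[of i j k] LG[of j k i] LG[of k i j] by (smt (verit))
  moreover have "df x (connection (gram f) i j x) \<bullet> partial k f x = L i j k"
    by (simp add: df_eq[OF x] connection_def L_def gram_def sum_2 inner_add)
  ultimately show ?thesis by (simp add: G_def)
qed

text \<open>For a surface in the unit sphere, \<open>normal_part i j\<close> is the second fundamental form
  \<open>\<alpha>(\<partial>\<^sub>i, \<partial>\<^sub>j)\<close> minus \<open>\<langle>\<partial>\<^sub>i, \<partial>\<^sub>j\<rangle> f\<close>.\<close>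

definition normal_part :: "2 \<Rightarrow> 2 \<Rightarrow> real^2 \<Rightarrow> 'e" where
  "normal_part i j x = partial i (partial j f) x - df x (connection (gram f) i j x)"

text \<open>The second fundamental form of \<open>f\<close> in the ambient Euclidean space, extended
  bilinearly from the coordinate fields.\<close>

definition normal_form :: "real^2 \<Rightarrow> real^2 \<Rightarrow> real^2 \<Rightarrow> 'e" where
  "normal_form x v w = (\<Sum>i\<in>UNIV. \<Sum>j\<in>UNIV. (v $ i * w $ j) *\<^sub>R normal_part i j x)"

lemma normal_part_partial: "x \<in> U \<Longrightarrow> normal_part i j x \<bullet> partial k f x = 0"
  by (simp add: normal_part_def inner_diff_left df_connection_inner)

lemma normal_part_df: "x \<in> U \<Longrightarrow> normal_part i j x \<bullet> df x v = 0"
  by (simp add: df_eq inner_add_right normal_part_partial)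

lemma normal_form_df: "x \<in> U \<Longrightarrow> normal_form x v w \<bullet> df x u = 0"
  by (simp add: normal_form_def sum_2 inner_add_left normal_part_df)

lemma normal_part_sym: "x \<in> U \<Longrightarrow> normal_part i j x = normal_part j i x"
  using christoffel_symmetric[of "gram f", OF gram_sym]
  by (simp add: normal_part_def partial_commute[OF smooth_f, of x i j] connection_def)

lemma smooth_normal_part: "smooth_on U (normal_part i j)"
  unfolding normal_part_def
  by (intro smooth_on_diff open_U smooth_on_partial smooth_f smooth_on_frechet_derivative_field
      smooth_connection)

text \<open>The product rule is applied to the expansion of \<open>df y (V y)\<close> in the partial
  derivatives of \<open>f\<close>. Splitting each second derivative into its tangential and normal
  parts then yields the two terms.\<close>

lemma gauss_formula:
  assumes x: "x \<in> U" and V: "V differentiable (at x)"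
  shows "frechet_derivative (\<lambda>y. df y (V y)) (at x) w =
    df x (cov_deriv (gram f) w V x) + normal_form x w (V x)"
proof -
  let ?P = "\<lambda>m. frechet_derivative (partial m f) (at x)"
  let ?V = "frechet_derivative V (at x)"
  have Vm: "((\<lambda>y. V y $ m) has_derivative (\<lambda>w. ?V w $ m)) (at x)" for m
    using bounded_linear.has_derivative[OF bounded_linear_vec_nth] V frechet_derivative_works by blast
  have Pm: "(partial m f has_derivative ?P m) (at x)" for m
    using differentiable_partial[OF x] frechet_derivative_works by blast
  have "((\<lambda>y. V y $ 1 *\<^sub>R partial 1 f y + V y $ 2 *\<^sub>R partial 2 f y) has_derivative
    (\<lambda>w. (V x $ 1 *\<^sub>R ?P 1 w + ?V w $ 1 *\<^sub>R partial 1 f x) +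
      (V x $ 2 *\<^sub>R ?P 2 w + ?V w $ 2 *\<^sub>R partial 2 f x))) (at x)"
    by (intro has_derivative_add has_derivative_scaleR Vm Pm)
  then have "((\<lambda>y. df y (V y)) has_derivative
    (\<lambda>w. (V x $ 1 *\<^sub>R ?P 1 w + ?V w $ 1 *\<^sub>R partial 1 f x) +
      (V x $ 2 *\<^sub>R ?P 2 w + ?V w $ 2 *\<^sub>R partial 2 f x))) (at x)"
    by (rule has_derivative_transform_within_open[OF _ open_U x]) (simp add: df_eq)
  note 1 = frechet_derivative_eqI[OF this, of w]
  have 2: "?P m w = w $ 1 *\<^sub>R partial 1 (partial m f) x + w $ 2 *\<^sub>R partial 2 (partial m f) x" for m
    using differentiable_partial[OF x] by (rule frechet_derivative_real2)
  have 3: "partial i (partial j f) x = normal_part i j x + df x (connection (gram f) i j x)" for i j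
    by (simp add: normal_part_def)
  show ?thesis
    by (simp add: 1 2 3 cov_deriv_connection normal_form_def sum_2 linear_add[OF linear_df[OF x]]
        linear_scale[OF linear_df[OF x]] df_eq[OF x, of "?V w"] algebra_simps)
qed

text \<open>By the Gauss formula the covariant derivative is mapped by the injective
  \<open>df x\<close> to the tangential part, which here is orthogonal to every tangent vector,
  hence to itself.\<close>

lemma cov_deriv_eq_0I:
  assumes x: "x \<in> U" and V: "V differentiable (at x)"
    and orth: "\<And>v. frechet_derivative (\<lambda>y. df y (V y)) (at x) w \<bullet> df x v = 0"
  shows "cov_deriv (gram f) w V x = 0"
proof -
  let ?c = "cov_deriv (gram f) w V x"
  have "df x ?c \<bullet> df x ?c = 0"
    using orth[of ?c] by (simp add: gauss_formula[OF x V] inner_add_left normal_form_df[OF x])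
  then show ?thesis using df_eq_0[OF x] by simp
qed

text \<open>The tangent field represented by \<open>connection\<close> is the second derivative of
  \<open>f\<close> minus its normal part. Differentiating it gives a third derivative, and
  orthogonality moves the derivative of the normal part onto \<open>partial l f\<close>, where only
  the normal component of the result counts.\<close>

lemma cov_deriv_connection_inner:
  assumes x: "x \<in> U"
  shows "df x (cov_deriv (gram f) (axis i 1) (connection (gram f) j k) x) \<bullet> partial l f x =
    partial i (partial j (partial k f)) x \<bullet> partial l f x + normal_part j k x \<bullet> normal_part i l x"
proof -
  let ?C = "connection (gram f) j k"
  have diff: "normal_part j k differentiable (at x)" "partial j (partial k f) differentiable (at x)"
    "?C differentiable (at x)"
    by (intro smooth_on_differentiable[OF _ x] smooth_normal_part smooth_on_partial smooth_f
        smooth_connection)+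
  have "df x (cov_deriv (gram f) (axis i 1) ?C x) \<bullet> partial l f x =
    frechet_derivative (\<lambda>y. df y (?C y)) (at x) (axis i 1) \<bullet> partial l f x"
    using normal_form_df[OF x, of _ _ "axis l 1"]
    by (simp add: gauss_formula[OF x diff(3)] inner_add_left partial_def)
  also have "(\<lambda>y. df y (?C y)) = (\<lambda>y. partial j (partial k f) y - normal_part j k y)"
    by (simp add: normal_part_def)
  also have "frechet_derivative \<dots> (at x) (axis i 1) =
      partial i (partial j (partial k f)) x - partial i (normal_part j k) x"
    unfolding partial_def[of i] using diff
    by (intro frechet_derivative_eqI has_derivative_diff) (simp_all add: frechet_derivative_works[symmetric])
  also have "\<dots> \<bullet> partial l f x = partial i (partial j (partial k f)) x \<bullet> partial l f x +
      normal_part j k x \<bullet> partial i (partial l f) x"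
    using inner_derivative_eq_minus[OF open_U normal_part_partial x diff(1) differentiable_partial[OF x]]
    by (simp add: partial_def[of i] inner_diff_left)
  also have "normal_part j k x \<bullet> partial i (partial l f) x = normal_part j k x \<bullet> normal_part i l x"
    by (simp add: normal_part_def[of i l] inner_diff_right normal_part_df[OF x])
  finally show ?thesis .
qed

lemma gauss_equation:
  assumes x: "x \<in> U"
  shows "metric_curvature (gram f) x * det (gram f x) =
    normal_part 1 1 x \<bullet> normal_part 2 2 x - normal_part 1 2 x \<bullet> normal_part 1 2 x"
proof -
  have "riemann (gram f) 1 2 2 x \<bullet> (gram f x *v axis 1 1) =
    df x (cov_deriv (gram f) (axis 1 1) (connection (gram f) 2 2) x) \<bullet> partial 1 f x -
    df x (cov_deriv (gram f) (axis 2 1) (connection (gram f) 1 2) x) \<bullet> partial 1 f x"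
    by (simp add: inner_gram[OF x] riemann_def cov_deriv_axis linear_diff[OF linear_df[OF x]]
        inner_diff_left partial_def)
  also have "\<dots> = normal_part 1 1 x \<bullet> normal_part 2 2 x - normal_part 1 2 x \<bullet> normal_part 1 2 x"
    \<comment> \<open>The two third derivatives of \<open>f\<close> cancel, leaving only products of
      normal parts.\<close>
    using partial_commute[OF smooth_on_partial[OF smooth_f] x, of 1 2 2]
    by (simp add: cov_deriv_connection_inner[OF x] normal_part_sym[OF x, of 2 1]
        inner_commute[of "normal_part 2 2 x"])
  finally show ?thesis
    using invertible_gram[OF x] by (simp add: metric_curvature_def invertible_det_nz)
qed

end

text \<open>An algebraic curvature tensor in dimension two has only one component.\<close>

lemma bilinear_form_det_2:
  fixes a b c :: "'e::real_inner" and x y :: "real^2"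
  defines "B \<equiv> \<lambda>v w :: real^2. (v $ 1 * w $ 1) *\<^sub>R a + (v $ 1 * w $ 2 + v $ 2 * w $ 1) *\<^sub>R b + (v $ 2 * w $ 2) *\<^sub>R c"
  shows "B x x \<bullet> B y y - B x y \<bullet> B x y = (x $ 1 * y $ 2 - x $ 2 * y $ 1)\<^sup>2 * (a \<bullet> c - b \<bullet> b)"
  unfolding B_def inner_add inner_scaleR_left inner_scaleR_right
  by (simp add: inner_commute[of b a] inner_commute[of c a] inner_commute[of c b]
      power2_eq_square algebra_simps)

section \<open>Surfaces of type D in a chart\<close>

lemma independent_pair_det_2:
  fixes x y :: "real^2"
  assumes "\<And>a b :: real. a *\<^sub>R x + b *\<^sub>R y = 0 \<Longrightarrow> a = 0 \<and> b = 0"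
  shows "x $ 1 * y $ 2 - x $ 2 * y $ 1 \<noteq> 0"
proof
  assume det: "x $ 1 * y $ 2 - x $ 2 * y $ 1 = 0"
  \<comment> \<open>Independence makes the coefficient \<open>- x $ i\<close> vanish for both
    \<open>i\<close>, so \<open>x\<close> is zero, which itself contradicts independence.\<close>
  have "y $ i *\<^sub>R x + (- x $ i) *\<^sub>R y = 0" for i
    using det exhaust_2[of i] by (auto simp: vec_eq_iff forall_2 algebra_simps)
  from assms[OF this] have "x = 0"
    by (simp add: vec_eq_iff)
  then show False
    using assms[of 1 0] by simp
qed

lemma decompose_2:
  fixes x y w :: "real^2"
  assumes "x $ 1 * y $ 2 - x $ 2 * y $ 1 \<noteq> 0"
  obtains a b where "w = a *\<^sub>R x + b *\<^sub>R y"
proof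
  define d where "d = x $ 1 * y $ 2 - x $ 2 * y $ 1"
  have d: "d \<noteq> 0" using assms by (simp add: d_def)
  have "d *\<^sub>R w = (w $ 1 * y $ 2 - w $ 2 * y $ 1) *\<^sub>R x + (x $ 1 * w $ 2 - x $ 2 * w $ 1) *\<^sub>R y"
    by (simp add: vec_eq_iff forall_2 d_def algebra_simps)
  then have "(1/d) *\<^sub>R (d *\<^sub>R w) =
      (1/d) *\<^sub>R ((w $ 1 * y $ 2 - w $ 2 * y $ 1) *\<^sub>R x + (x $ 1 * w $ 2 - x $ 2 * w $ 1) *\<^sub>R y)"
    by simp
  then show "w = ((w $ 1 * y $ 2 - w $ 2 * y $ 1) / d) *\<^sub>R x + ((x $ 1 * w $ 2 - x $ 2 * w $ 1) / d) *\<^sub>R y"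
    using d by (simp add: scaleR_add_right)
qed

section \<open>Patches in the unit sphere\<close>

locale sphere_patch = immersed_patch U f
  for U and f :: "real^2 \<Rightarrow> 'e::euclidean_space" +
  assumes on_sphere: "x \<in> U \<Longrightarrow> f x \<bullet> f x = 1"
begin

lemma df_position: assumes "x \<in> U" shows "df x v \<bullet> f x = 0"
  using inner_derivative_eq_minus[OF open_U on_sphere assms differentiable_f[OF assms] differentiable_f[OF assms], of v]
  by (simp add: inner_commute)

text \<open>Differentiating the orthogonality of \<open>partial j f\<close> and the position vector
  shows that the radial part of the Euclidean second fundamental form is minus the metric.\<close>

lemma normal_part_position:
  assumes x: "x \<in> U"
  shows "normal_part i j x \<bullet> f x = - (partial i f x \<bullet> partial j f x)"
proof -
  have "partial j f y \<bullet> f y = 0" if "y \<in> U" for y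
    using df_position[OF that] by (simp add: partial_def)
  from inner_derivative_eq_minus[OF open_U this x differentiable_partial[OF x] differentiable_f[OF x], of "axis i 1"]
  show ?thesis
    by (simp add: normal_part_def inner_diff_left df_position[OF x] partial_def
        inner_commute[of "df x (axis j 1)"])
qed

lemma normal_form_position:
  "x \<in> U \<Longrightarrow> normal_form x v w \<bullet> f x = - (df x v \<bullet> df x w)"
  by (simp add: normal_form_def sum_2 inner_add normal_part_position df_eq algebra_simps)

text \<open>The value on \<open>v\<close>, \<open>v\<close> is not assumed radial, but the Gauss
  equation pairs it only with the radial value on \<open>w\<close>, \<open>w\<close>. So all terms
  are determined by the metric and combine to the Gram determinant of \<open>v\<close> and
  \<open>w\<close>, as on the round sphere.\<close>

lemma curvature_eq_1:
  assumes x: "x \<in> U" and det: "v $ 1 * w $ 2 - v $ 2 * w $ 1 \<noteq> 0"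
    and vw: "normal_form x v w = a *\<^sub>R f x" and ww: "normal_form x w w = b *\<^sub>R f x"
  shows "metric_curvature (gram f) x = 1"
proof -
  let ?d = "(v $ 1 * w $ 2 - v $ 2 * w $ 1)\<^sup>2"
  have a: "a = - (df x v \<bullet> df x w)" and b: "b = - (df x w \<bullet> df x w)"
    using normal_form_position[OF x] on_sphere[OF x] vw ww by (metis inner_scaleR_left mult_1_right)+
  have form: "normal_form x v w = (v $ 1 * w $ 1) *\<^sub>R normal_part 1 1 x +
      (v $ 1 * w $ 2 + v $ 2 * w $ 1) *\<^sub>R normal_part 1 2 x + (v $ 2 * w $ 2) *\<^sub>R normal_part 2 2 x" for v w
    by (simp add: normal_form_def sum_2 normal_part_sym[OF x, of 2 1] algebra_simps)
  have "?d * (metric_curvature (gram f) x * det (gram f x)) =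
      normal_form x v v \<bullet> normal_form x w w - normal_form x v w \<bullet> normal_form x v w"
    unfolding gauss_equation[OF x] form by (rule bilinear_form_det_2[symmetric])
  also have "\<dots> = (df x v \<bullet> df x v) * (df x w \<bullet> df x w) - (df x v \<bullet> df x w)\<^sup>2"
    using on_sphere[OF x] by (simp add: ww vw normal_form_position[OF x] a b power2_eq_square)
  also have "\<dots> = ?d * det (gram f x)"
    by (simp add: df_eq[OF x] det_2 gram_def inner_add inner_commute[of "partial 2 f x" "partial 1 f x"]
        power2_eq_square algebra_simps)
  finally show ?thesis
    using det invertible_gram[OF x] by (simp add: invertible_det_nz)
qed

end

text \<open>Here \<open>k\<close> and \<open>Z\<close> are only specified on \<open>U\<close>, so that they can be instantiated by globally
  defined objects read in a chart.\<close>

locale type_D_patch = sphere_patch U f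
  for U and f :: "real^2 \<Rightarrow> 'e::euclidean_space" +
  fixes X Y Z :: "real^2 \<Rightarrow> real^2" and k :: "real^2 \<Rightarrow> 'e"
  assumes smooth_X: "smooth_on U X" and smooth_Y: "smooth_on U Y"
    and k_eq: "x \<in> U \<Longrightarrow> k x = df x (Y x)"
    and Z_eq: "x \<in> U \<Longrightarrow> Z x = (- inverse (df x (X x) \<bullet> df x (Y x))) *\<^sub>R X x"
    and independent: "x \<in> U \<Longrightarrow> X x $ 1 * Y x $ 2 - X x $ 2 * Y x $ 1 \<noteq> 0"
    and unit_Y: "x \<in> U \<Longrightarrow> df x (Y x) \<bullet> df x (Y x) = 1"
    and oblique: "x \<in> U \<Longrightarrow> df x (X x) \<bullet> df x (Y x) \<noteq> 0"
    and parallel: "x \<in> U \<Longrightarrow> cov_deriv (gram f) (X x) Y x = 0"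
    and conjugate: "x \<in> U \<Longrightarrow>
      frechet_derivative k (at x) (X x) = (frechet_derivative k (at x) (X x) \<bullet> f x) *\<^sub>R f x"
begin

abbreviation dk :: "real^2 \<Rightarrow> real^2 \<Rightarrow> 'e" where
  "dk x \<equiv> frechet_derivative k (at x)"

lemma smooth_k: "smooth_on U k"
proof (rule smooth_on_cong[OF open_U])
  show "smooth_on U (\<lambda>x. df x (Y x))"
    by (intro smooth_on_frechet_derivative_field open_U smooth_f smooth_Y)
qed (simp add: k_eq)

lemma smooth_Z: "smooth_on U Z"
proof (rule smooth_on_cong[OF open_U])
  show "smooth_on U (\<lambda>x. (- inverse (df x (X x) \<bullet> df x (Y x))) *\<^sub>R X x)"
    using oblique
    by (intro smooth_on_scaleR smooth_on_minus smooth_on_inverse smooth_on_inner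
      smooth_on_frechet_derivative_field open_U smooth_f smooth_Y smooth_X) auto
qed (simp add: Z_eq)

lemma differentiable_k: "x \<in> U \<Longrightarrow> k differentiable (at x)"
  using smooth_k smooth_on_differentiable by blast

lemma linear_dk: "x \<in> U \<Longrightarrow> linear (dk x)"
  by (intro linear_frechet_derivative differentiable_k)

lemma dk_eq:
  assumes x: "x \<in> U"
  shows "dk x w = df x (cov_deriv (gram f) w Y x) + normal_form x w (Y x)"
proof -
  have "dk x = frechet_derivative (\<lambda>y. df y (Y y)) (at x)"
    using differentiable_k[OF x] open_U x by (rule frechet_derivative_transform_within_open) (rule k_eq)
  moreover have "Y differentiable (at x)"
    using smooth_Y x by (rule smooth_on_differentiable)
  ultimately show ?thesis by (simp add: gauss_formula[OF x])
qed

lemma dk_position: "x \<in> U \<Longrightarrow> dk x w \<bullet> f x = - (df x w \<bullet> k x)"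
  by (simp add: dk_eq inner_add_left df_position normal_form_position k_eq)

text \<open>The derivative along \<open>X\<close> is radial by \<open>conjugate\<close>, and
  \<open>dk_position\<close> determines the factor.\<close>

lemma dk_X:
  assumes x: "x \<in> U"
  shows "dk x (X x) = - (df x (X x) \<bullet> df x (Y x)) *\<^sub>R f x"
  using conjugate[OF x] dk_position[OF x, of "X x"] by (simp add: k_eq[OF x])

lemma dk_Z: "x \<in> U \<Longrightarrow> dk x (Z x) = f x"
  using oblique by (simp add: Z_eq dk_X linear_scale[OF linear_dk] linear_neg[OF linear_dk])

lemma dk_Y_not_radial:
  assumes x: "x \<in> U" and curvature: "metric_curvature (gram f) x \<noteq> 1"
  shows "dk x (Y x) \<noteq> c *\<^sub>R f x"
proof
  assume dkY: "dk x (Y x) = c *\<^sub>R f x"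
  let ?T = "df x (cov_deriv (gram f) (Y x) Y x)"
  \<comment> \<open>\<open>?T\<close> is the tangential part of \<open>dk x (Y x)\<close>. It is
    orthogonal to the normal form and, being tangent to the sphere, to the radial vector
    \<open>dk x (Y x)\<close>; so it vanishes.\<close>
  have "?T \<bullet> ?T = (dk x (Y x) - normal_form x (Y x) (Y x)) \<bullet> ?T"
    by (simp add: dk_eq[OF x])
  also have "\<dots> = 0"
    using normal_form_df[OF x] df_position[OF x]
    by (simp add: dkY inner_diff_left inner_commute[of "f x"])
  finally have "normal_form x (Y x) (Y x) = c *\<^sub>R f x"
    using dkY by (simp add: dk_eq[OF x])
  moreover have "normal_form x (X x) (Y x) = - (df x (X x) \<bullet> df x (Y x)) *\<^sub>R f x"
    using dk_X[OF x] dk_eq[OF x, of "X x"] linear_0[OF linear_df[OF x]]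
    by (simp add: parallel[OF x])
  ultimately show False
    using curvature_eq_1[OF x independent[OF x]] curvature by blast
qed

text \<open>\<open>dk\<close> sends \<open>X\<close> to a nonzero multiple of the position vector
  and \<open>Y\<close> to no multiple of it, so the images of this basis are independent. The
  condition on \<open>Y\<close> replaces the one on curvature because it can be carried from one
  chart to another.\<close>

lemma inj_dk:
  assumes x: "x \<in> U" and not_radial: "\<And>c. dk x (Y x) \<noteq> c *\<^sub>R f x"
  shows "inj (dk x)"
proof -
  have "w = 0" if "dk x w = 0" for w
  proof -
    obtain a b where w: "w = a *\<^sub>R X x + b *\<^sub>R Y x"
      using decompose_2[OF independent[OF x]] .
    have eq: "b *\<^sub>R dk x (Y x) = (a * (df x (X x) \<bullet> df x (Y x))) *\<^sub>R f x"
      using that by (simp add: w linear_add[OF linear_dk[OF x]] linear_scale[OF linear_dk[OF x]] dk_X[OF x])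
    have "b = 0"
    proof (rule ccontr)
      assume "b \<noteq> 0"
      then have "dk x (Y x) = (1/b) *\<^sub>R (b *\<^sub>R dk x (Y x))"
        by simp
      also have "\<dots> = (a * (df x (X x) \<bullet> df x (Y x)) / b) *\<^sub>R f x"
        unfolding eq by simp
      finally show False using not_radial by blast
    qed
    moreover have "f x \<noteq> 0"
      using on_sphere[OF x] by auto
    ultimately have "a = 0"
      using eq oblique[OF x] by simp
    then show ?thesis using w \<open>b = 0\<close> by simp
  qed
  then show ?thesis
    using linear_injective_0[OF linear_dk[OF x]] by blast
qed

lemma dk_Y_dk_Z: "x \<in> U \<Longrightarrow> dk x (Y x) \<bullet> dk x (Z x) = -1"
  using unit_Y by (simp add: dk_Z dk_position k_eq)

lemma cov_deriv_Z:
  assumes x: "x \<in> U" and inj: "\<And>y. y \<in> U \<Longrightarrow> inj (dk y)"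
  shows "cov_deriv (gram k) (Y x) Z x = 0"
proof -
  \<comment> \<open>Since \<open>Y\<close> has unit length, \<open>k\<close> is itself an immersed
    patch in the sphere, and the Gauss formula applies to it.\<close>
  interpret k: sphere_patch U k
    using open_U smooth_k inj unit_Y by unfold_locales (auto simp: k_eq)
  show ?thesis
  proof (rule k.cov_deriv_eq_0I[OF x])
    show "Z differentiable (at x)"
      using smooth_Z x by (rule smooth_on_differentiable)
    \<comment> \<open>The field is \<open>f\<close> itself, so its derivative along \<open>Y\<close>
      is the position vector \<open>k x\<close>, orthogonal to the image of
      \<open>dk x\<close>.\<close>
    have "((\<lambda>y. dk y (Z y)) has_derivative df x) (at x)"
      using differentiable_f[OF x] unfolding frechet_derivative_works
      by (rule has_derivative_transform_within_open[OF _ open_U x]) (simp add: dk_Z)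
    then show "frechet_derivative (\<lambda>y. dk y (Z y)) (at x) (Y x) \<bullet> dk x v = 0" for v
      using k.df_position[OF x] by (simp add: frechet_derivative_eqI k_eq[OF x, symmetric] inner_commute)
  qed
qed

end

section \<open>Passage to the manifold\<close>

lemma ind_metric_eq_gram: "ind_metric g c = gram (g \<circ> param c)"
  by (simp add: ind_metric_def gram_def fun_eq_iff)

lemma chart_facts:
  assumes "smooth_atlas A" "c \<in> A"
  shows "open (range_of c)" "p \<in> dom_of c \<Longrightarrow> param c (coord c p) = p"
  using assms unfolding smooth_atlas_def is_chart_def homeomorphism_def by blast+

text \<open>This is for \<open>levi_civita\<close>, whose components vanish in every chart: the
  derivative in the chart chosen by \<open>pushforward\<close> is linear and sends zero to
  zero.\<close>

lemma pushforward_eq_0: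
  assumes "smooth_atlas A" "smooth_map A F" "\<And>c p. c \<in> A \<Longrightarrow> p \<in> dom_of c \<Longrightarrow> V c p = 0"
  shows "pushforward A F V p = 0"
proof -
  let ?c = "chart_at A p"
  have c: "?c \<in> A" "p \<in> dom_of ?c"
    using chart_at[OF assms(1)] by auto
  then have "(F \<circ> param ?c) differentiable (at (coord ?c p))"
    using assms(2) unfolding smooth_map_def by (meson imageI smooth_on_differentiable)
  then show ?thesis
    using linear_0[OF linear_frechet_derivative] assms(3)[OF c]
    by (simp add: pushforward_def Let_def)
qed

lemma linear_transition:
  assumes "smooth_atlas A" "c \<in> A" "d \<in> A" "p \<in> dom_of c \<inter> dom_of d"
  shows "linear (frechet_derivative (coord d \<circ> param c) (at (coord c p)))"
  using assms unfolding smooth_atlas_def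
  by (meson imageI linear_frechet_derivative smooth_on_differentiable)

section \<open>The map \<open>k\<close> and its fields on the whole surface\<close>

locale type_D_surface =
  fixes A :: "'l::{t2_space,second_countable_topology} chart set"
    and g :: "'l \<Rightarrow> 'e::euclidean_space" and X Y :: "'l vfield"
  assumes atlas: "smooth_atlas A" and immersed: "immersed_surface A g"
    and fields: "type_D_fields A g X Y"
    and curvature: "gauss_curvature A g p \<noteq> 1"
begin

definition k :: "'l \<Rightarrow> 'e" where
  "k = pushforward A g Y"

definition Z :: "'l vfield" where
  "Z c p = (- inverse (ind_inner A g X Y p)) *\<^sub>R X c p"

lemma smooth_map_g: "smooth_map A g"
  using immersed by (simp add: immersed_surface_def)

lemma smooth_field_X: "smooth_vector_field A X" and smooth_field_Y: "smooth_vector_field A Y"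
  using fields by (simp_all add: type_D_fields_def)

lemma g_in_chart:
  assumes c: "c \<in> A" "p \<in> dom_of c"
  shows "pushforward A g X p = frechet_derivative (g \<circ> param c) (at (coord c p)) (X c p)"
    and "pushforward A g Y p = frechet_derivative (g \<circ> param c) (at (coord c p)) (Y c p)"
  using pushforward_in_chart[OF atlas smooth_map_g _ c] smooth_field_X smooth_field_Y by auto

lemma smooth_map_k: "smooth_map A k"
  unfolding smooth_map_def
proof
  fix c assume c: "c \<in> A"
  let ?f = "g \<circ> param c"
  have U: "open (range_of c)" using chart_facts[OF atlas c] by simp
  show "smooth_on (range_of c) (k \<circ> param c)"
  \<comment> \<open>The chart chosen in \<open>pushforward\<close> may jump from point to point;
    smoothness is therefore read off from the expression in the fixed chart
    \<open>c\<close>.\<close>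
  proof (rule smooth_on_cong[OF U])
    show "smooth_on (range_of c) (\<lambda>x. frechet_derivative ?f (at x) ((Y c \<circ> param c) x))"
      using smooth_map_g smooth_field_Y c unfolding smooth_map_def smooth_vector_field_def
      by (intro smooth_on_frechet_derivative_field[OF U, where V = "Y c \<circ> param c"]) blast+
    show "frechet_derivative ?f (at x) ((Y c \<circ> param c) x) = (k \<circ> param c) x"
      if "x \<in> range_of c" for x
      using that g_in_chart(2)[OF c] chart_facts(2)[OF atlas c] by (auto simp: k_def)
  qed
qed

lemma k_in_chart:
  assumes "smooth_vector_field A V" "c \<in> A" "p \<in> dom_of c"
  shows "pushforward A k V p = frechet_derivative (k \<circ> param c) (at (coord c p)) (V c p)"
  using assms by (intro pushforward_in_chart[OF atlas smooth_map_k])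

text \<open>With both \<open>levi_civita\<close> and \<open>second_ff\<close> zero, the projection
  of the derivative to the sphere vanishes, leaving its radial part.\<close>

lemma pushforward_k_X: "pushforward A k X p = (pushforward A k X p \<bullet> g p) *\<^sub>R g p"
proof -
  have "pushforward A g (levi_civita g X Y) p = 0"
    using fields by (intro pushforward_eq_0[OF atlas smooth_map_g]) (simp add: type_D_fields_def)
  moreover have "second_ff A g X Y p = 0"
    using fields by (simp add: type_D_fields_def)
  ultimately show ?thesis
    by (simp add: second_ff_def sphere_cov_def k_def)
qed

lemma type_D_patch_chart:
  assumes c: "c \<in> A"
  shows "type_D_patch (range_of c) (g \<circ> param c) (X c \<circ> param c) (Y c \<circ> param c)
    (Z c \<circ> param c) (k \<circ> param c)"
proof
  note simps = chart_facts(2)[OF atlas c] g_in_chart[OF c, symmetric]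
    k_in_chart[OF smooth_field_X c, symmetric] k_in_chart[OF smooth_field_Y c, symmetric]
  note D = fields[unfolded type_D_fields_def]
  show "open (range_of c)" using chart_facts[OF atlas c] by simp
  show "smooth_on (range_of c) (g \<circ> param c)"
    using smooth_map_g c by (simp add: smooth_map_def)
  show "smooth_on (range_of c) (X c \<circ> param c)" "smooth_on (range_of c) (Y c \<circ> param c)"
    using smooth_field_X smooth_field_Y c by (simp_all add: smooth_vector_field_def)
  fix x assume "x \<in> range_of c"
  then obtain p where p: "p \<in> dom_of c" and x: "x = coord c p" by auto
  show "inj (frechet_derivative (g \<circ> param c) (at x))"
    using immersed c p by (simp add: immersed_surface_def x)
  show "(g \<circ> param c) x \<bullet> (g \<circ> param c) x = 1"
    using immersed by (simp add: immersed_surface_def power2_norm_eq_inner[symmetric])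
  show "(k \<circ> param c) x = frechet_derivative (g \<circ> param c) (at x) ((Y c \<circ> param c) x)"
    by (simp add: x p simps k_def)
  show "(Z c \<circ> param c) x =
      (- inverse (frechet_derivative (g \<circ> param c) (at x) ((X c \<circ> param c) x) \<bullet>
        frechet_derivative (g \<circ> param c) (at x) ((Y c \<circ> param c) x))) *\<^sub>R (X c \<circ> param c) x"
    by (simp add: x p simps Z_def ind_inner_def)
  show "(X c \<circ> param c) x $ 1 * (Y c \<circ> param c) x $ 2 - (X c \<circ> param c) x $ 2 * (Y c \<circ> param c) x $ 1 \<noteq> 0"
    using D c p by (intro independent_pair_det_2) (simp add: x simps pointwise_independent_def)
  show "frechet_derivative (g \<circ> param c) (at x) ((Y c \<circ> param c) x) \<bullet>
      frechet_derivative (g \<circ> param c) (at x) ((Y c \<circ> param c) x) = 1"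
    using D by (simp add: x p simps ind_inner_def)
  show "frechet_derivative (g \<circ> param c) (at x) ((X c \<circ> param c) x) \<bullet>
      frechet_derivative (g \<circ> param c) (at x) ((Y c \<circ> param c) x) \<noteq> 0"
    using D by (simp add: x p simps ind_inner_def)
  show "cov_deriv (gram (g \<circ> param c)) ((X c \<circ> param c) x) (Y c \<circ> param c) x = 0"
    using D c p by (simp add: x simps levi_civita_def ind_metric_eq_gram)
  show "frechet_derivative (k \<circ> param c) (at x) ((X c \<circ> param c) x) =
      (frechet_derivative (k \<circ> param c) (at x) ((X c \<circ> param c) x) \<bullet> (g \<circ> param c) x) *\<^sub>R (g \<circ> param c) x"
    using pushforward_k_X[of p] by (simp add: x p simps)
qed

text \<open>\<open>gauss_curvature\<close> is read in the single chart \<open>chart_at A p\<close>. Its chart independence is not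
  needed: the hypothesis is used in that chart, and the conclusion is then moved to other charts.\<close>

lemma pushforward_k_Y_not_radial: "pushforward A k Y p \<noteq> t *\<^sub>R g p"
proof -
  let ?c = "chart_at A p"
  have c: "?c \<in> A" "p \<in> dom_of ?c"
    using chart_at[OF atlas] by auto
  interpret type_D_patch "range_of ?c" "g \<circ> param ?c" "X ?c \<circ> param ?c" "Y ?c \<circ> param ?c"
    "Z ?c \<circ> param ?c" "k \<circ> param ?c"
    by (rule type_D_patch_chart[OF c(1)])
  show ?thesis
    using dk_Y_not_radial[of "coord ?c p" t] c curvature[of p]
    by (simp add: gauss_curvature_def Let_def ind_metric_eq_gram k_in_chart[OF smooth_field_Y c]
        chart_facts(2)[OF atlas c(1)])
qed

lemma inj_derivative_k:
  assumes c: "c \<in> A" and x: "x \<in> range_of c"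
  shows "inj (frechet_derivative (k \<circ> param c) (at x))"
proof -
  interpret type_D_patch "range_of c" "g \<circ> param c" "X c \<circ> param c" "Y c \<circ> param c"
    "Z c \<circ> param c" "k \<circ> param c"
    by (rule type_D_patch_chart[OF c])
  obtain p where p: "p \<in> dom_of c" and "x = coord c p" using x by auto
  then show ?thesis
    using pushforward_k_Y_not_radial[of p]
    by (intro inj_dk[OF x]) (simp add: k_in_chart[OF smooth_field_Y c p] chart_facts(2)[OF atlas c])
qed

lemma smooth_field_Z: "smooth_vector_field A Z"
  unfolding smooth_vector_field_def
proof (intro conjI ballI)
  fix c assume c: "c \<in> A"
  interpret type_D_patch "range_of c" "g \<circ> param c" "X c \<circ> param c" "Y c \<circ> param c"
    "Z c \<circ> param c" "k \<circ> param c"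
    by (rule type_D_patch_chart[OF c])
  show "smooth_on (range_of c) (Z c \<circ> param c)" by (rule smooth_Z)
  fix d p assume d: "d \<in> A" and p: "p \<in> dom_of c \<inter> dom_of d"
  have "X d p = frechet_derivative (coord d \<circ> param c) (at (coord c p)) (X c p)"
    using smooth_field_X c d p
    unfolding smooth_vector_field_def by blast
  \<comment> \<open>The factor in \<open>Z\<close> is a function on the surface, the same in both
    charts, so it passes through the linear transition derivative.\<close>
  then show "Z d p = frechet_derivative (coord d \<circ> param c) (at (coord c p)) (Z c p)"
    unfolding Z_def linear_scale[OF linear_transition[OF atlas c d p]] by simp
qed

text \<open>As an equality of functions it can be substituted into \<open>second_ff\<close>, where
  the field along \<open>k\<close> to be differentiated becomes \<open>g\<close>. It also gives
  \<open>Z\<close> unit length.\<close>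

lemma pushforward_k_Z: "pushforward A k Z = g"
proof
  fix p
  let ?c = "chart_at A p"
  have c: "?c \<in> A" "p \<in> dom_of ?c"
    using chart_at[OF atlas] by auto
  interpret type_D_patch "range_of ?c" "g \<circ> param ?c" "X ?c \<circ> param ?c" "Y ?c \<circ> param ?c"
    "Z ?c \<circ> param ?c" "k \<circ> param ?c"
    by (rule type_D_patch_chart[OF c(1)])
  show "pushforward A k Z p = g p"
    using dk_Z[of "coord ?c p"] c
    by (simp add: k_in_chart[OF smooth_field_Z c]
        chart_facts(2)[OF atlas c(1)])
qed

lemma norm_g: "norm (g p) = 1"
  using immersed by (simp add: immersed_surface_def)

lemma norm_k: "norm (k p) = 1"
  using fields by (simp add: type_D_fields_def ind_inner_def k_def norm_eq_sqrt_inner)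

lemma immersed_k: "immersed_surface A k"
  unfolding immersed_surface_def using smooth_map_k norm_k inj_derivative_k by auto

lemma ind_inner_k_Y_Z: "ind_inner A k Y Z p = -1"
proof -
  let ?c = "chart_at A p"
  have c: "?c \<in> A" "p \<in> dom_of ?c"
    using chart_at[OF atlas] by auto
  interpret type_D_patch "range_of ?c" "g \<circ> param ?c" "X ?c \<circ> param ?c" "Y ?c \<circ> param ?c"
    "Z ?c \<circ> param ?c" "k \<circ> param ?c"
    by (rule type_D_patch_chart[OF c(1)])
  show ?thesis
    using dk_Y_dk_Z[of "coord ?c p"] c
    by (simp add: ind_inner_def k_in_chart[OF smooth_field_Z c]
        k_in_chart[OF smooth_field_Y c] chart_facts(2)[OF atlas c(1)])
qed

lemma levi_civita_k_Y_Z: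
  assumes c: "c \<in> A" and p: "p \<in> dom_of c"
  shows "levi_civita k Y Z c p = 0"
proof -
  interpret type_D_patch "range_of c" "g \<circ> param c" "X c \<circ> param c" "Y c \<circ> param c"
    "Z c \<circ> param c" "k \<circ> param c"
    by (rule type_D_patch_chart[OF c])
  show ?thesis
    using cov_deriv_Z[of "coord c p"] inj_derivative_k[OF c] p
    by (simp add: levi_civita_def ind_metric_eq_gram chart_facts(2)[OF atlas c])
qed

lemma second_ff_k_Y_Z: "second_ff A k Y Z p = 0"
proof -
  have "pushforward A k (levi_civita k Y Z) p = 0"
    using levi_civita_k_Y_Z by (intro pushforward_eq_0[OF atlas smooth_map_k])
  \<comment> \<open>The derivative of \<open>g\<close> along \<open>Y\<close> is the position vector
    \<open>k p\<close>, which the projection to the tangent space of the sphere at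
    \<open>k p\<close> removes.\<close>
  moreover have "sphere_cov A k Y g p = 0"
    using norm_k[of p] by (simp add: sphere_cov_def k_def[symmetric] power2_norm_eq_inner[symmetric])
  ultimately show ?thesis
    by (simp add: second_ff_def pushforward_k_Z)
qed

lemma independent_Y_Z: "pointwise_independent A Y Z"
  unfolding pointwise_independent_def
proof (intro ballI allI impI)
  fix c p and a b :: real
  assume c: "c \<in> A" "p \<in> dom_of c" and eq: "a *\<^sub>R Y c p + b *\<^sub>R Z c p = 0"
  let ?i = "ind_inner A g X Y p"
  have "(- b * inverse ?i) *\<^sub>R X c p + a *\<^sub>R Y c p = 0"
    using eq by (simp add: Z_def add.commute)
  then have "- b * inverse ?i = 0 \<and> a = 0"
    using fields c unfolding type_D_fields_def pointwise_independent_def by blast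
  moreover have "?i \<noteq> 0"
    using fields by (simp add: type_D_fields_def)
  ultimately show "a = 0 \<and> b = 0" by simp
qed

lemma type_D_fields_k: "type_D_fields A k Y Z"
  unfolding type_D_fields_def
  using smooth_field_Y smooth_field_Z independent_Y_Z ind_inner_k_Y_Z levi_civita_k_Y_Z second_ff_k_Y_Z norm_g
  by (simp add: ind_inner_def[of A k Z Z] pushforward_k_Z power2_norm_eq_inner[symmetric])

end

theorem proposition6:
  fixes A :: "'l::{t2_space,second_countable_topology} chart set"
    and g k :: "'l \<Rightarrow> 'e::euclidean_space"
    and X\<^sub>g Y\<^sub>g :: "'l vfield"
    and n :: nat
  assumes "n \<ge> 3" and "DIM('e) = n + 1"
    and "smooth_atlas A"
    and "type_D A g"
    and "\<forall>p. gauss_curvature A g p \<noteq> 1"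
    and "type_D_fields A g X\<^sub>g Y\<^sub>g"
    and "k = pushforward A g Y\<^sub>g"
  shows "type_D A k"
proof -
  interpret D: type_D_surface A g X\<^sub>g Y\<^sub>g
    using assms by unfold_locales (auto simp: type_D_def)
  have "k = D.k"
    by (simp add: assms(7) D.k_def)
  then show ?thesis
    unfolding type_D_def using D.immersed_k D.type_D_fields_k by blast
qed

end
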